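(* Let $p,q\in\mathbb{Z}$ be distinct prime numbers. Then the generalised Baumslag--Solitar group \[G=\langle a,s,t \mid sas^{-1}=a^p,\ tat^{-1}=a^q\rangle\] has undecidable Diophantine problem.
   Context: An equation over a finitely generated group $G$ with variables from a finite set $\mathcal X$ is an element $w\in G*F(\mathcal X)$; a solution is a homomorphism $G*F(\mathcal X)\to G$ restricting to the identity on $G$ and sending $w$ to $1$. A system of equations is a finite collection of equations in the same variables. The Diophantine problem for $G$ asks for an algorithm that, given a finite system of equations over $G$, decides whether it has a solution. *)

theory Defs
  imports Main "HOL-Computational_Algebra.Primes" "HOL-Library.Nat_Bijection"
begin

datatype recf = Zero | Succ | Proj nat | Comp recf "recf list" | Prec recf recf | Mini recf

inductive eval :: "recf \<Rightarrow> nat list \<Rightarrow> nat \<Rightarrow> bool" where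
  eval_zero: "eval Zero xs 0"
| eval_succ: "eval Succ (x # xs) (Suc x)"
| eval_proj: "i < length xs \<Longrightarrow> eval (Proj i) xs (xs ! i)"
| eval_comp: "list_all2 (\<lambda>g y. eval g xs y) gs ys \<Longrightarrow> eval f ys z \<Longrightarrow> eval (Comp f gs) xs z"
| eval_prec0: "eval f xs z \<Longrightarrow> eval (Prec f g) (0 # xs) z"
| eval_precS: "eval (Prec f g) (n # xs) y \<Longrightarrow> eval g (n # y # xs) z
                 \<Longrightarrow> eval (Prec f g) (Suc n # xs) z"
| eval_mini: "eval f (n # xs) 0 \<Longrightarrow> (\<forall>m<n. \<exists>k. k \<noteq> 0 \<and> eval f (m # xs) k)
                 \<Longrightarrow> eval (Mini f) xs n"

datatype gen = A | S | T

text \<open>A letter is a pair (inverted?, symbol); a word is a list of letters.\<close>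
type_synonym 'x word = "(bool \<times> 'x) list"

definition inv_word :: "'x word \<Rightarrow> 'x word" where
  "inv_word w = rev (map (\<lambda>(b, x). (\<not> b, x)) w)"

definition a_pow :: "int \<Rightarrow> gen word" where
  "a_pow n = replicate (nat \<bar>n\<bar>) (n < 0, A)"

definition relators :: "int \<Rightarrow> int \<Rightarrow> gen word set" where
  "relators p q = { [(False, S), (False, A), (True, S)] @ a_pow (- p),
                    [(False, T), (False, A), (True, T)] @ a_pow (- q) }"

inductive geq :: "int \<Rightarrow> int \<Rightarrow> gen word \<Rightarrow> gen word \<Rightarrow> bool" for p q where
  geq_refl: "geq p q u u"
| geq_sym: "geq p q u v \<Longrightarrow> geq p q v u"
| geq_trans: "geq p q u v \<Longrightarrow> geq p q v w \<Longrightarrow> geq p q u w"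
| geq_cancel: "geq p q (u @ [(b, x), (\<not> b, x)] @ v) (u @ v)"
| geq_rel: "r \<in> relators p q \<Longrightarrow> geq p q (u @ r @ v) (u @ v)"

text \<open>An equation is a word over the constants of G (Inl) and variables (Inr);
  a system is a finite list of equations.\<close>
type_synonym equation = "(gen + nat) word"

definition subst :: "(nat \<Rightarrow> gen word) \<Rightarrow> equation \<Rightarrow> gen word" where
  "subst \<sigma> w = concat (map (\<lambda>(b, l). case l of
        Inl g \<Rightarrow> [(b, g)]
      | Inr i \<Rightarrow> (if b then inv_word (\<sigma> i) else \<sigma> i)) w)"

definition solvable :: "int \<Rightarrow> int \<Rightarrow> equation list \<Rightarrow> bool" where
  "solvable p q sys \<longleftrightarrow> (\<exists>\<sigma>. \<forall>w \<in> set sys. geq p q (subst \<sigma> w) [])"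

fun gen_code :: "gen \<Rightarrow> nat" where
  "gen_code A = 0" | "gen_code S = 1" | "gen_code T = 2"

definition sym_code :: "gen + nat \<Rightarrow> nat" where
  "sym_code l = (case l of Inl g \<Rightarrow> gen_code g | Inr i \<Rightarrow> i + 3)"

definition letter_code :: "bool \<times> (gen + nat) \<Rightarrow> nat" where
  "letter_code bl = 2 * sym_code (snd bl) + (if fst bl then 1 else 0)"

definition encode_system :: "equation list \<Rightarrow> nat" where
  "encode_system sys = list_encode (map (\<lambda>w. list_encode (map letter_code w)) sys)"

end

theory Submission
  imports Defs Complex_Main "HOL-Library.Countable" "HOL-Number_Theory.Cong"
begin

text \<open>
  An integer is represented by an element commuting with \<open>s\<close>, through its exponent sum in \<open>s\<close>.
  Sums are products in the group. If \<open>w\<close> commutes with \<open>s\<^sup>n t\<close>, then its exponent sums \<open>i\<close>, \<open>j\<close> in \<open>s\<close>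
  and \<open>t\<close> satisfy \<open>i = n j\<close> (map the group to the Heisenberg group, killing \<open>a\<close>), and exponent sums of
  two elements are compared by conjugating \<open>a\<close>, because \<open>p\<close> and \<open>q\<close> are multiplicatively independent.
  This gives multiplication. With \<open>e = p q\<close>, the translation part of \<open>(a (s t)\<^sup>k)\<^sup>y\<close> under the affine
  representation is \<open>(e\<^sup>k\<^sup>y - 1) / (e\<^sup>k - 1)\<close>, which is congruent to \<open>y\<close> modulo \<open>e\<^sup>k - 1\<close>; comparing it
  with that of \<open>s\<^sup>n a s\<^sup>-\<^sup>n\<close> for large \<open>k\<close> defines the relation \<open>y = p\<^sup>n\<close>, and forces \<open>n \<ge> 0\<close>. So no Pell
  equations are needed: all exponential Diophantine relations are available.

  The value of a recursive function is witnessed by a finite sequence of numbers in which every entry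
  follows from two earlier ones by one of finitely many polynomial clauses. Coding the sequence by
  Goedel's beta function leaves a single bounded universal quantifier, which is eliminated as in the
  theorem of Davis, Putnam and Robinson, with the binomial coefficient \<open>K choose y\<close> as modulus.

  If a recursive function decided solvability, the negation of its answer on the system
  \<open>x = s\<^sup>n \<and> D\<close>, where \<open>n\<close> is the code of \<open>D\<close>, would be expressed by some system \<open>D\<close> in the
  parameter \<open>x\<close>; taking \<open>n\<close> to be the code of this \<open>D\<close> is contradictory.
\<close>

section \<open>Words in the group and two representations\<close>

lemma inv_word_simps [simp]:
  "inv_word [] = []"
  "inv_word (u @ v) = inv_word v @ inv_word u"
  "inv_word (inv_word u) = u"
  by (auto simp: inv_word_def rev_map[symmetric] comp_def case_prod_unfold)

lemma geq_ctx: "geq p q u v \<Longrightarrow> geq p q (x @ u @ y) (x @ v @ y)"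
proof (induction rule: geq.induct)
  case (geq_cancel u b z v)
  show ?case using geq.geq_cancel[of p q "x @ u" b z "v @ y"] by simp
next
  case (geq_rel r u v)
  then show ?case using geq.geq_rel[of r p q "x @ u" "v @ y"] by simp
qed (blast intro: geq.intros)+

lemma geq_append: "geq p q u u' \<Longrightarrow> geq p q v v' \<Longrightarrow> geq p q (u @ v) (u' @ v')"
  using geq_ctx[of p q u u' "[]" v] geq_ctx[of p q v v' u' "[]"] by (auto intro: geq_trans)

lemma geq_inv_right: "geq p q (w @ inv_word w) []"
proof (induction w)
  case Nil
  show ?case by (simp add: geq_refl)
next
  case (Cons x w)
  obtain b g where x: "x = (b, g)" by force
  have "geq p q ([x] @ (w @ inv_word w) @ [(\<not> b, g)]) ([x] @ [] @ [(\<not> b, g)])"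
    by (rule geq_ctx[OF Cons])
  moreover have "geq p q ([x] @ [] @ [(\<not> b, g)]) []"
    using geq_cancel[of p q "[]" b g "[]"] by (simp add: x)
  ultimately show ?case by (auto intro: geq_trans simp: x inv_word_def)
qed

lemma geq_inv_left: "geq p q (inv_word w @ w) []"
  using geq_inv_right[of p q "inv_word w"] by simp

lemma geq_append_inv_iff: "geq p q (u @ inv_word v) [] \<longleftrightarrow> geq p q u v"
proof
  assume h: "geq p q (u @ inv_word v) []"
  have "geq p q (u @ (inv_word v @ v)) u"
    using geq_append[OF geq_refl geq_inv_left] by force
  moreover have "geq p q ((u @ inv_word v) @ v) v"
    using geq_append[OF h geq_refl] by force
  ultimately show "geq p q u v" by (metis append.assoc geq_sym geq_trans)
next
  assume h: "geq p q u v"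
  then show "geq p q (u @ inv_word v) []"
    by (meson geq_append geq_inv_right geq_refl geq_trans)
qed

lemma geq_inv_append_iff: "geq p q (inv_word u @ v) [] \<longleftrightarrow> geq p q u v"
proof
  assume h: "geq p q (inv_word u @ v) []"
  have "geq p q ((u @ inv_word u) @ v) v"
    using geq_append[OF geq_inv_right geq_refl] by force
  moreover have "geq p q (u @ (inv_word u @ v)) u"
    using geq_append[OF geq_refl h] by force
  ultimately show "geq p q u v" by (metis append.assoc geq_sym geq_trans)
next
  assume h: "geq p q u v"
  then show "geq p q (inv_word u @ v) []"
    by (meson geq_append geq_inv_left geq_refl geq_trans geq_sym)
qed

text \<open>\<open>es\<close>, \<open>et\<close> and \<open>hz\<close> are the coordinates of the homomorphism to the integral Heisenberg group
  that kills \<open>a\<close>.\<close>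
fun es :: "gen word \<Rightarrow> int" where
  "es [] = 0"
| "es ((b, g) # w) = (if g = S then if b then -1 else 1 else 0) + es w"

fun et :: "gen word \<Rightarrow> int" where
  "et [] = 0"
| "et ((b, g) # w) = (if g = T then if b then -1 else 1 else 0) + et w"

fun hz :: "gen word \<Rightarrow> int" where
  "hz [] = 0"
| "hz ((b, g) # w) = es [(b, g)] * et w + hz w"

lemma es_append [simp]: "es (u @ v) = es u + es v"
  by (induction u rule: es.induct) auto

lemma et_append [simp]: "et (u @ v) = et u + et v"
  by (induction u rule: et.induct) auto

lemma hz_append: "hz (u @ v) = hz u + hz v + es u * et v"
  by (induction u rule: hz.induct) (auto simp: algebra_simps)

locale gbs =
  fixes p q :: int
  assumes prime_p: "prime p" and prime_q: "prime q" and p_neq_q: "p \<noteq> q"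
begin

abbreviation eqG (infix "\<approx>" 50) where "u \<approx> v \<equiv> geq p q u v"

lemma p_ge: "p \<ge> 2" and q_ge: "q \<ge> 2"
  using prime_p prime_q prime_ge_2_int by auto

definition e :: int where "e = p * q"

lemma e_ge: "e \<ge> 4"
  unfolding e_def using mult_mono[OF p_ge q_ge] p_ge by simp

text \<open>The affine representation sends \<open>w\<close> to \<open>x \<mapsto> de w * x + tr w\<close>.\<close>
fun de :: "gen word \<Rightarrow> real" where
  "de [] = 1"
| "de ((b, g) # w) = (case g of A \<Rightarrow> 1 | S \<Rightarrow> if b then 1 / p else p
                                | T \<Rightarrow> if b then 1 / q else q) * de w"

fun tr :: "gen word \<Rightarrow> real" where
  "tr [] = 0"
| "tr ((b, g) # w) = (if g = A then if b then -1 else 1 else 0) + de [(b, g)] * tr w"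

lemma de_append [simp]: "de (u @ v) = de u * de v"
  by (induction u rule: de.induct) auto

lemma tr_append [simp]: "tr (u @ v) = tr u + de u * tr v"
  by (induction u rule: tr.induct) (auto simp: algebra_simps)

lemma rep_a_replicate:
  "es (replicate n (b, A)) = 0" "et (replicate n (b, A)) = 0" "hz (replicate n (b, A)) = 0"
  "de (replicate n (b, A)) = 1" "tr (replicate n (b, A)) = (if b then - real n else real n)"
  by (induction n) auto

text \<open>Both maps send cancelling pairs and the two relators to the identity, so they are well
  defined on group elements; for the affine map this is \<open>p * (x / p + 1) - p = x\<close>, and
  likewise for \<open>q\<close>.\<close>

lemma geq_rep:
  "u \<approx> v \<Longrightarrow> es u = es v \<and> et u = et v \<and> hz u = hz v \<and> de u = de v \<and> tr u = tr v"
proof (induction rule: geq.induct)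
  case (geq_cancel u b x v)
  show ?case using p_ge q_ge by (cases x; cases b; auto simp: hz_append algebra_simps)
next
  case (geq_rel r u v)
  have "es r = 0 \<and> et r = 0 \<and> hz r = 0 \<and> de r = 1 \<and> tr r = 0"
    using geq_rel p_ge q_ge
    by (auto simp: relators_def a_pow_def rep_a_replicate)
  then show ?case by (simp add: hz_append)
qed auto

text \<open>In the Heisenberg group the two products differ only in the central coordinate, by
  \<open>es u * et v - es v * et u\<close>.\<close>

lemma heis_commute:
  assumes "u @ v \<approx> v @ u"
  shows "es u * et v = es v * et u"
  using geq_rep[OF assms] by (auto simp: hz_append algebra_simps)

lemma de_eq: "de w = p powi es w * q powi et w"
proof (induction w rule: de.induct)
  case (2 b g w)
  then show ?case using p_ge q_ge
    by (cases g; cases b) (auto simp: power_int_add power_int_diff power_int_minus field_simps)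
qed simp

lemma de_pos: "de w > 0"
  using p_ge q_ge by (simp add: de_eq)

text \<open>Translation parts lie in Z[1/e]. Their denominators are units modulo
  \<open>e ^ k - 1\<close>, so that congruences modulo this number still make sense.\<close>

lemma tr_denominator: "\<exists>N::nat. tr w * of_int (e ^ N) \<in> \<int>"
proof (induction w rule: tr.induct)
  case 1
  show ?case by auto
next
  case (2 b g w)
  then obtain N where N: "tr w * of_int (e ^ N) \<in> \<int>" by blast
  have de: "de [(b, g)] * of_int e \<in> \<int>"
    using p_ge q_ge by (cases g; cases b) (auto simp: e_def)
  have "tr ((b, g) # w) * of_int (e ^ Suc N) =
     (if g = A then if b then -1 else 1 else 0) * of_int (e ^ Suc N)
     + (de [(b, g)] * of_int e) * (tr w * of_int (e ^ N))"
    by (simp add: algebra_simps)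
  also have "\<dots> \<in> \<int>" by (intro Ints_add Ints_mult[OF de N]) auto
  finally show ?case by blast
qed

text \<open>Multiplicative independence of distinct primes: once negative exponents are moved to the
  other side, this is unique factorisation in the naturals.\<close>

lemma powi_eq_1_imp:
  assumes "(of_int p :: real) powi i * of_int q powi j = 1"
  shows "i = 0 \<and> j = 0"
proof -
  define P Q where "P = nat p" and "Q = nat q"
  have pr: "prime P" "prime Q" "P \<noteq> Q" and pq: "p = int P" "q = int Q"
    using prime_p prime_q p_neq_q p_ge q_ge by (auto simp: P_def Q_def)
  have coprime: "coprime (P ^ m) (Q ^ n)" for m n
    using primes_coprime[OF pr] by simp
  \<comment> \<open>Positive and negative parts of the exponents. One part of each pair is zero, so
    \<open>i1 = i2\<close> forces \<open>i = 0\<close>.\<close>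
  define i1 i2 j1 j2 where "i1 = nat i" "i2 = nat (-i)" "j1 = nat j" "j2 = nat (-j)"
  note d = i1_i2_j1_j2_def
  have nz: "(of_nat P::real) \<noteq> 0" "(of_nat Q::real) \<noteq> 0" using pr by auto
  have "(of_nat P::real) powi i = of_nat P ^ i1 / of_nat P ^ i2"
       "(of_nat Q::real) powi j = of_nat Q ^ j1 / of_nat Q ^ j2"
    by (auto simp: d power_int_def divide_inverse power_inverse)
  then have "(of_nat P ^ i1 / of_nat P ^ i2) * (of_nat Q ^ j1 / of_nat Q ^ j2) = (1::real)"
    using assms by (simp only: pq of_int_of_nat_eq)
  then have "real (P ^ i1 * Q ^ j1) = real (P ^ i2 * Q ^ j2)"
    using nz by (simp add: field_simps)
  then have eq: "P ^ i1 * Q ^ j1 = P ^ i2 * Q ^ j2" using of_nat_eq_iff by blast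
  have "P ^ i1 dvd P ^ i2 * Q ^ j2" "Q ^ j1 dvd P ^ i2 * Q ^ j2"
    by (simp_all flip: eq)
  moreover have "P ^ i2 dvd P ^ i1 * Q ^ j1" "Q ^ j2 dvd P ^ i1 * Q ^ j1"
    by (simp_all add: eq)
  ultimately have "P ^ i1 dvd P ^ i2" "P ^ i2 dvd P ^ i1" "Q ^ j1 dvd Q ^ j2" "Q ^ j2 dvd Q ^ j1"
    using coprime coprime[THEN coprime_commute[THEN iffD1]]
    by (simp_all only: coprime_dvd_mult_left_iff coprime_dvd_mult_right_iff)
  then have "i1 = i2" "j1 = j2"
    using prime_ge_2_nat[OF pr(1)] prime_ge_2_nat[OF pr(2)]
    by (simp_all add: dvd_power_iff_le)
  then show ?thesis by (auto simp: d)
qed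

lemma de_eq_imp:
  assumes "de u = de v"
  shows "es u = es v \<and> et u = et v"
proof -
  have "(of_int p :: real) powi (es u - es v) * of_int q powi (et u - et v) = 1"
    using assms p_ge q_ge by (auto simp: de_eq power_int_diff)
  from powi_eq_1_imp[OF this] show ?thesis by simp
qed

text \<open>Linear parts show that \<open>b\<close> acts as a translation, and translation parts
  show that its length is \<open>de u\<close>. Hence \<open>b\<close> alone determines the linear
  part of \<open>u\<close>.\<close>

lemma same_conj_imp:
  assumes "u @ [(False, A)] \<approx> b @ u" "v @ [(False, A)] \<approx> b @ v"
  shows "es u = es v \<and> et u = et v"
proof (rule de_eq_imp)
  have "de u = de b * de u" "de u = tr b + (de b - 1) * tr u"
    using geq_rep[OF assms(1)] by (auto simp: algebra_simps)
  then have "de u = tr b" using de_pos[of u] by simp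
  moreover have "de v = de b * de v" "de v = tr b + (de b - 1) * tr v"
    using geq_rep[OF assms(2)] by (auto simp: algebra_simps)
  then have "de v = tr b" using de_pos[of v] by simp
  ultimately show "de u = de v" by simp
qed


section \<open>Recognising \<open>p ^ n\<close> by a congruence modulo
  \<open>e ^ k - 1\<close>\<close>

lemma power_expansion_mod_square:
  fixes x :: int
  shows "\<exists>g. x ^ i = 1 + int i * (x - 1) + g * (x - 1)\<^sup>2"
proof (induction i)
  case (Suc i)
  then obtain g where g: "x ^ i = 1 + int i * (x - 1) + g * (x - 1)\<^sup>2" by blast
  have "x ^ Suc i = x ^ i + (x - 1) * x ^ i" by (simp add: algebra_simps)
  also have "\<dots> = 1 + int (Suc i) * (x - 1) + (g + int i + g * (x - 1)) * (x - 1)\<^sup>2"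
    unfolding g by (simp add: algebra_simps power2_eq_square)
  finally show ?case by blast
qed simp

text \<open>This is the reason for \<open>k = y * y + n * n + 1\<close>: the modulus
  \<open>e ^ k - 1\<close> exceeds the difference to be shown zero, for either sign of
  \<open>n\<close> and \<open>y\<close>.\<close>

lemma exponent_bound:
  fixes n y :: int
  shows "p ^ nat n + \<bar>y\<bar> * p ^ nat (- n) < e ^ nat (y * y + n * n + 1) - 1"
proof -
  define U W where "U = e ^ nat (n * n)" and "W = e ^ nat (y * y)"
  have sq: "\<bar>x\<bar> \<le> x * x" for x :: int
    using mult_left_mono[of 1 "\<bar>x\<bar>" "\<bar>x\<bar>"] by (cases "x = 0") auto
  have pe: "p \<le> e" "1 \<le> p" using p_ge q_ge by (auto simp: e_def)
  have pU: "p ^ i \<le> U" if "int i \<le> \<bar>n\<bar>" for i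
  proof -
    have "p ^ i \<le> e ^ i" using pe by (intro power_mono) auto
    also have "\<dots> \<le> U" unfolding U_def using that sq[of n] e_ge
      by (intro power_increasing) auto
    finally show ?thesis .
  qed
  have "\<bar>y\<bar> \<le> 2 ^ nat \<bar>y\<bar>"
    using less_exp[of "nat \<bar>y\<bar>"] by (metis abs_ge_zero less_imp_le nat_eq_iff2 of_nat_le_iff of_nat_numeral of_nat_power)
  also have "\<dots> \<le> e ^ nat \<bar>y\<bar>" using e_ge by (intro power_mono) auto
  also have "\<dots> \<le> W" unfolding W_def using sq[of y] e_ge by (intro power_increasing) auto
  finally have yW: "\<bar>y\<bar> \<le> W" .
  have U1: "U \<ge> 1" "W \<ge> 1" using e_ge by (auto simp: U_def W_def)
  have p1: "p ^ nat n \<le> U" "p ^ nat (- n) \<le> U" by (rule pU; simp)+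
  have "\<bar>y\<bar> * p ^ nat (- n) \<le> W * U"
    using yW p1 U1 pe by (intro mult_mono) auto
  moreover have "U \<le> W * U" using U1 by simp
  moreover have WU: "W * U \<ge> 1" using U1 by (metis mult_mono' mult_1 zero_le_one)
  moreover have "nat (y * y + n * n + 1) = nat (y * y) + nat (n * n) + 1"
    by (simp add: nat_add_distrib)
  then have "e ^ nat (y * y + n * n + 1) = e * (W * U)"
    by (simp add: U_def W_def power_add)
  moreover have "e * (W * U) \<ge> 4 * (W * U)" using e_ge WU by (intro mult_right_mono) auto
  ultimately show ?thesis using p1 by linarith
qed

text \<open>By \<open>b1\<close>, the number \<open>b\<close> is
  \<open>(e^(k y) - 1) / (e^k - 1)\<close>, congruent to \<open>y\<close> modulo
  \<open>e^k - 1\<close>; by \<open>b2\<close> it is congruent to \<open>p^n\<close>. Both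
  congruences live in Z[1/e], where the modulus is coprime to \<open>e\<close>, and its size turns
  them into an equality.\<close>

lemma exponent_determined:
  fixes n y k m :: int and b c :: real
  assumes k: "k = y * y + n * n + 1" and m: "m = k * y"
    and b1: "b * (of_int e powi k - 1) = of_int e powi m - 1"
    and b2: "b = of_int p powi n + (of_int e powi k - 1) * c"
    and c: "c * of_int (e ^ N) \<in> \<int>"
  shows "0 \<le> n \<and> y = p ^ nat n"
proof -
  define X M where "X = e ^ nat k" and "M = X - 1"
  define y1 y2 n1 n2 where "y1 = nat y" "y2 = nat (- y)" "n1 = nat n" "n2 = nat (- n)"
  note d = y1_y2_n1_n2_def
  obtain c' where c': "c * of_int (e ^ N) = of_int c'" using c Ints_cases by blast
  have k0: "k \<ge> 1" unfolding k by simp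
  have ek: "(of_int e :: real) powi k = of_int X"
    using k0 by (simp add: X_def power_int_def)
  have X4: "X \<ge> 4" using e_ge k0 self_le_power[of e "nat k"] by (simp add: X_def)
  have em: "(of_int e :: real) powi m = of_int X ^ y1 / of_int X ^ y2"
    unfolding m power_int_mult ek by (auto simp: d power_int_def divide_inverse power_inverse)
  have pn: "(of_int p :: real) powi n = of_int p ^ n1 / of_int p ^ n2"
    by (auto simp: d power_int_def divide_inverse power_inverse)
  \<comment> \<open>To first order \<open>X ^ i\<close> is \<open>1 + i * M\<close>; dividing
    \<open>X ^ y1 - X ^ y2\<close> by \<open>M\<close> therefore leaves \<open>y\<close> modulo
    \<open>M\<close>.\<close>
  obtain g1 where g1: "X ^ y1 = 1 + int y1 * M + g1 * M\<^sup>2"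
    using power_expansion_mod_square M_def by blast
  obtain g2 where g2: "X ^ y2 = 1 + int y2 * M + g2 * M\<^sup>2"
    using power_expansion_mod_square M_def by blast
  have yy: "y = int y1 - int y2" by (auto simp: d)
  have X0: "(of_int X :: real) > 0" using X4 by simp
  have p0: "(of_int p :: real) > 0" using p_ge by simp
  \<comment> \<open>The factors \<open>X ^ y2\<close>, \<open>p ^ n2\<close> and
    \<open>e ^ N\<close> clear the denominators due to negative \<open>y\<close>, to negative
    \<open>n\<close> and to \<open>c\<close>.\<close>
  have "b * of_int M * of_int X ^ y2 = of_int X ^ y1 - of_int X ^ y2"
    using b1 X0 unfolding ek em M_def by (simp add: field_simps)
  also have "\<dots> = of_int (X ^ y1 - X ^ y2)" by simp
  also have "\<dots> = of_int M * of_int (y + (g1 - g2) * M)"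
    unfolding g1 g2 yy of_int_mult[symmetric] of_int_eq_iff
    by (simp add: algebra_simps power2_eq_square)
  finally have bX: "b * of_int X ^ y2 = of_int (y + (g1 - g2) * M)"
    using X4 by (simp add: M_def)
  have bp: "b * of_int p ^ n2 * of_int e ^ N = of_int (p ^ n1 * e ^ N + M * c' * p ^ n2)"
  proof -
    have "b * of_int p ^ n2 * of_int e ^ N =
        (of_int p ^ n1 / of_int p ^ n2) * of_int p ^ n2 * of_int e ^ N
        + of_int M * (c * of_int (e ^ N)) * of_int p ^ n2"
      unfolding b2 ek pn M_def by (simp add: algebra_simps)
    then show ?thesis unfolding c' using p0 by simp
  qed
  have "real_of_int ((p ^ n1 * e ^ N + M * c' * p ^ n2) * X ^ y2)
      = real_of_int ((y + (g1 - g2) * M) * p ^ n2 * e ^ N)"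
    unfolding of_int_mult bp[symmetric] bX[symmetric] by simp
  then have eq: "(p ^ n1 * e ^ N + M * c' * p ^ n2) * X ^ y2 = (y + (g1 - g2) * M) * p ^ n2 * e ^ N"
    by (simp only: of_int_eq_iff)
  \<comment> \<open>Modulo \<open>M\<close> the factor \<open>X ^ y2\<close> is 1, by
    \<open>g2\<close>.\<close>
  have "e ^ N * (p ^ n1 - y * p ^ n2) =
     M * ((g1 - g2) * p ^ n2 * e ^ N - c' * p ^ n2 * X ^ y2 - p ^ n1 * e ^ N * (int y2 + g2 * M))"
    using eq[unfolded distrib_right, unfolded mult.assoc] g2
    by (simp add: algebra_simps power2_eq_square)
  then have "M dvd e ^ N * (p ^ n1 - y * p ^ n2)" by simp
  moreover have "coprime M (e ^ N)"
  proof -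
    have "coprime (e ^ nat k - 1) (e ^ nat k)"
      by (rule coprime_diff_one_left)
    then have "coprime M e" using k0 by (simp add: M_def X_def)
    then show ?thesis by simp
  qed
  ultimately have dvd: "M dvd p ^ n1 - y * p ^ n2"
    using coprime_dvd_mult_right_iff by blast
  have "\<bar>p ^ n1 - y * p ^ n2\<bar> \<le> p ^ n1 + \<bar>y\<bar> * p ^ n2"
    using p_ge abs_triangle_ineq4[of "p ^ n1" "y * p ^ n2"] by (simp add: abs_mult)
  also have "\<dots> < M" using exponent_bound[of n y] by (simp add: M_def X_def k d)
  finally have "p ^ n1 = y * p ^ n2" using dvd dvd_imp_le_int[of "p ^ n1 - y * p ^ n2" M] by force
  \<comment> \<open>A negative \<open>n\<close> would give \<open>1 = y * p ^ n2\<close> with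
    \<open>n2 > 0\<close>, so \<open>p\<close> would divide 1.\<close>
  moreover have "n2 = 0"
  proof (rule ccontr)
    assume "n2 \<noteq> 0"
    then have "n1 = 0" and "p dvd y * p ^ n2" by (auto simp: d)
    with \<open>p ^ n1 = y * p ^ n2\<close> have "p dvd 1" by simp
    then show False using p_ge by auto
  qed
  ultimately show ?thesis by (auto simp: d)
qed

end

section \<open>Arithmetic by equations over the group\<close>

text \<open>In \<open>IsExp n y k m\<close> the intended meaning is \<open>y = p^n\<close>; the
  numbers \<open>k = y * y + n * n + 1\<close> and \<open>m = k * y\<close> are arguments because
  they are computed by sum and product atoms.\<close>

datatype 'n atom = IsOne 'n | IsSum 'n 'n 'n | IsProd 'n 'n 'n | IsExp 'n 'n 'n 'n

text \<open>Indexing auxiliary variables by the atom that owns them keeps those of different atoms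
  apart, so solutions of single atoms can be combined.\<close>

datatype 'n gvar = Num 'n | Aux "'n atom" nat

instance atom :: (countable) countable
  by countable_datatype

instance gvar :: (countable) countable
  by countable_datatype

text \<open>An equation between positive words, whose letters are generators and variables.\<close>
type_synonym 'v peq = "(gen + 'v) list \<times> (gen + 'v) list"

definition commute :: "(gen + 'v) list \<Rightarrow> (gen + 'v) list \<Rightarrow> 'v peq" where
  "commute u v = (u @ v, v @ u)"

text \<open>\<open>transport u b\<close> says that \<open>b\<close> is the conjugate of the generator \<open>a\<close> by \<open>u\<close>; if \<open>u\<close> and
  \<open>v\<close> transport \<open>a\<close> to the same \<open>b\<close>, their exponent sums in \<open>s\<close> and \<open>t\<close> agree.\<close>
definition transport :: "(gen + 'v) list \<Rightarrow> (gen + 'v) list \<Rightarrow> 'v peq" where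
  "transport u b = (u @ [Inl A], b @ u)"

text \<open>Forces \<open>y\<close> and \<open>z\<close> to behave as \<open>t\<^sup>m\<close> and \<open>(st)\<^sup>m\<close> if \<open>x\<close> behaves as \<open>s\<^sup>m\<close>.\<close>
definition copies :: "'v \<Rightarrow> 'v \<Rightarrow> 'v \<Rightarrow> 'v \<Rightarrow> 'v peq list" where
  "copies x y z b =
     [commute [Inr y] [Inl T], commute [Inr z] [Inl S, Inl T],
      transport [Inr z] [Inr b], transport [Inr x, Inr y] [Inr b]]"

definition is_num :: "'n \<Rightarrow> 'n gvar peq" where
  "is_num x = commute [Inr (Num x)] [Inl S]"

text \<open>Intended values for \<open>IsProd\<close>: \<open>X 3\<close> is
  \<open>(s^n t)^m\<close>, which must conjugate \<open>a\<close> exactly as \<open>s^k t^m\<close>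
  does. For \<open>IsExp\<close>: \<open>X 10\<close> is \<open>(s t)^k\<close>, \<open>X 4\<close>
  is \<open>(s t)^m\<close>, \<open>X 6\<close> is \<open>(a (s t)^k)^y\<close>, \<open>X 7\<close>
  is a power of \<open>a\<close>, \<open>X 8\<close> the commutator of \<open>X 10\<close> and
  \<open>X 7\<close>, and \<open>X 9\<close> is \<open>s^n a s^-n\<close>.\<close>

fun atom_eqs :: "'n atom \<Rightarrow> 'n gvar peq list" where
  "atom_eqs (IsOne x) = [([Inr (Num x)], [Inl S])]"
| "atom_eqs (IsSum x y z) = [is_num x, is_num y, is_num z, ([Inr (Num x), Inr (Num y)], [Inr (Num z)])]"
| "atom_eqs (IsProd n m k) = (let X = Aux (IsProd n m k) in
     [is_num n, is_num m, is_num k] @ copies (Num m) (X 0) (X 5) (X 2) @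
     [commute [Inr (X 3)] [Inr (Num n), Inl T],
      transport [Inr (X 3)] [Inr (X 4)], transport [Inr (Num k), Inr (X 0)] [Inr (X 4)]])"
| "atom_eqs (IsExp n y k m) = (let X = Aux (IsExp n y k m) in
     [is_num n, is_num y, is_num k, is_num m] @
     copies (Num k) (X 0) (X 10) (X 2) @ copies (Num m) (X 3) (X 4) (X 5) @
     [commute [Inr (X 6)] [Inl A, Inr (X 10)], transport [Inr (X 6)] [Inr (X 5)],
      commute [Inr (X 7)] [Inl A],
      ([Inr (X 10), Inr (X 7)], [Inr (X 8), Inr (X 7), Inr (X 10)]),
      ([Inr (X 9), Inr (Num n)], [Inr (Num n), Inl A]),
      ([Inr (X 6)], [Inr (X 9), Inr (X 8), Inr (X 4)])])"

section \<open>Evaluation of positive equations and powers of words\<close>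

definition wsub :: "('v \<Rightarrow> gen word) \<Rightarrow> (gen + 'v) list \<Rightarrow> gen word" where
  "wsub \<rho> L = concat (map (case_sum (\<lambda>g. [(False, g)]) \<rho>) L)"

lemma wsub_simps [simp]:
  "wsub \<rho> [] = []"
  "wsub \<rho> (Inl g # L) = (False, g) # wsub \<rho> L"
  "wsub \<rho> (Inr x # L) = \<rho> x @ wsub \<rho> L"
  "wsub \<rho> (L @ L') = wsub \<rho> L @ wsub \<rho> L'"
  by (auto simp: wsub_def)

definition wpow :: "gen word \<Rightarrow> nat \<Rightarrow> gen word" where
  "wpow w n = concat (replicate n w)"

lemma wpow_0 [simp]: "wpow w 0 = []" and wpow_Suc [simp]: "wpow w (Suc n) = w @ wpow w n"
  by (auto simp: wpow_def)

lemma wpow_commute: "wpow w n @ w = w @ wpow w n"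
  by (induction n) auto

lemma wpow_add: "wpow w (m + n) = wpow w m @ wpow w n"
  by (induction m) auto

lemma wpow_mult: "wpow w (m * n) = wpow (wpow w m) n"
  by (induction n) (auto simp: wpow_add)

lemma es_spow [simp]: "es (wpow [(False, S)] n) = int n"
  by (induction n) auto

abbreviation spow :: "nat \<Rightarrow> gen word" where "spow n \<equiv> wpow [(False, S)] n"
abbreviation apow :: "nat \<Rightarrow> gen word" where "apow n \<equiv> wpow [(False, A)] n"

definition peq_word :: "('v::countable) peq \<Rightarrow> equation" where
  "peq_word E = map (\<lambda>l. (False, map_sum id to_nat l)) (fst E)
     @ inv_word (map (\<lambda>l. (False, map_sum id to_nat l)) (snd E))"

lemma subst_append: "subst \<sigma> (u @ v) = subst \<sigma> u @ subst \<sigma> v"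
  by (simp add: subst_def)

lemma subst_inv_word: "subst \<sigma> (inv_word w) = inv_word (subst \<sigma> w)"
proof (induction w)
  case (Cons x w)
  obtain b l where x: "x = (b, l)" by force
  have "inv_word (x # w) = inv_word w @ [(\<not> b, l)]" by (simp add: x inv_word_def)
  moreover have "subst \<sigma> [(\<not> b, l)] = inv_word (subst \<sigma> [(b, l)])"
    by (cases l) (auto simp: subst_def, auto simp: inv_word_def)
  moreover have "subst \<sigma> (x # w) = subst \<sigma> [(b, l)] @ subst \<sigma> w"
    using subst_append[of \<sigma> "[x]" w] by (simp add: x)
  ultimately show ?case using Cons by (simp add: subst_append)
qed (simp add: subst_def)

lemma subst_positive:
  "subst \<sigma> (map (\<lambda>l. (False, map_sum id to_nat l)) L) = wsub (\<lambda>x. \<sigma> (to_nat x)) L"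
  by (induction L) (auto simp: subst_def wsub_def split: sum.splits)

definition atoms_system :: "('n::countable) atom list \<Rightarrow> equation list" where
  "atoms_system as = concat (map (\<lambda>a. map peq_word (atom_eqs a)) as)"

text \<open>The equation \<open>x = s^n\<close>, which feeds the parameter \<open>n\<close> to a
  system.\<close>

definition param_word :: "nat \<Rightarrow> nat \<Rightarrow> equation" where
  "param_word r n = (True, Inr r) # replicate n (False, Inl S)"

context gbs
begin

section \<open>Words that conjugate \<open>a\<close> to its powers, and equations that hold in the
  group\<close>

definition holds :: "('v \<Rightarrow> gen word) \<Rightarrow> 'v peq \<Rightarrow> bool" where
  "holds \<rho> E \<longleftrightarrow> wsub \<rho> (fst E) \<approx> wsub \<rho> (snd E)"

lemma a_pow_of_nat: "a_pow (int n) = apow n"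
  by (induction n) (auto simp: a_pow_def nat_add_distrib)

lemma apow_1: "apow 1 = [(False, A)]" by simp

text \<open>Conjugation by \<open>w\<close> acts on powers of \<open>a\<close> as raising to the
  power \<open>N\<close>. The form without inverses composes directly along positive words.\<close>

definition pushes :: "gen word \<Rightarrow> nat \<Rightarrow> bool" where
  "pushes w N \<longleftrightarrow> (\<forall>n. w @ apow n \<approx> apow (N * n) @ w)"

lemma pushes_Nil: "pushes [] 1"
  by (simp add: pushes_def geq_refl)

lemma pushes_append:
  assumes "pushes u M" "pushes v N"
  shows "pushes (u @ v) (M * N)"
  unfolding pushes_def
proof
  fix n
  have "u @ (v @ apow n) \<approx> u @ (apow (N * n) @ v)"
    by (rule geq_append[OF geq_refl assms(2)[unfolded pushes_def, rule_format]])
  moreover have "(u @ apow (N * n)) @ v \<approx> (apow (M * (N * n)) @ u) @ v"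
    by (rule geq_append[OF assms(1)[unfolded pushes_def, rule_format] geq_refl])
  ultimately show "(u @ v) @ apow n \<approx> apow (M * N * n) @ u @ v"
    by (auto intro: geq_trans simp: mult.assoc)
qed

lemma pushes_wpow: "pushes w N \<Longrightarrow> pushes (wpow w k) (N ^ k)"
  by (induction k) (auto simp: pushes_append pushes_Nil[simplified])

lemma pushes_singletonI:
  assumes "[x, (False, A)] \<approx> apow N @ [x]"
  shows "pushes [x] N"
  unfolding pushes_def
proof
  fix n
  show "[x] @ apow n \<approx> apow (N * n) @ [x]"
  proof (induction n)
    case (Suc n)
    have "[x, (False, A)] @ apow n \<approx> (apow N @ [x]) @ apow n"
      by (intro geq_append assms geq_refl)
    moreover have "apow N @ ([x] @ apow n) \<approx> apow N @ (apow (N * n) @ [x])"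
      by (rule geq_append[OF geq_refl Suc])
    ultimately show ?case by (auto intro: geq_trans simp: wpow_add)
  qed (simp add: geq_refl)
qed

lemma pushes_A: "pushes [(False, A)] 1"
  by (rule pushes_singletonI) (simp add: geq_refl)

lemma pushes_relator:
  assumes r: "[(False, g), (False, A), (True, g)] @ a_pow (- k) \<in> relators p q" and k: "k \<ge> 0"
  shows "pushes [(False, g)] (nat k)"
proof (rule pushes_singletonI)
  have neg: "a_pow (- k) = inv_word (apow (nat k))"
    using k by (simp add: a_pow_of_nat[symmetric]) (auto simp: a_pow_def inv_word_def)
  have "[(False, g), (False, A), (True, g)] @ a_pow (- k) \<approx> []"
    using geq_rel[OF r, of "[]" "[]"] by simp
  then have "[(False, g), (False, A), (True, g)] \<approx> apow (nat k)"
    by (simp only: neg geq_append_inv_iff)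
  then have "[(False, g), (False, A), (True, g)] @ [(False, g)] \<approx> apow (nat k) @ [(False, g)]"
    by (intro geq_append geq_refl)
  moreover have "[(False, g), (False, A), (True, g)] @ [(False, g)] \<approx> [(False, g), (False, A)]"
    using geq_cancel[of p q "[(False, g), (False, A)]" True g "[]"] by simp
  ultimately show "[(False, g), (False, A)] \<approx> apow (nat k) @ [(False, g)]"
    by (meson geq_sym geq_trans)
qed

abbreviation "P \<equiv> nat p"
abbreviation "Q \<equiv> nat q"

lemma pushes_S: "pushes [(False, S)] P" and pushes_T: "pushes [(False, T)] Q"
  using p_ge q_ge by (auto intro!: pushes_relator simp: relators_def)

lemma pushes_ST: "pushes [(False, S), (False, T)] (P * Q)"
  using pushes_append[OF pushes_S pushes_T] by simp

lemma pushesD: "pushes w N \<Longrightarrow> w @ [(False, A)] \<approx> apow N @ w"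
  unfolding pushes_def by (metis apow_1 mult.right_neutral)

lemma holds_transport: "pushes (wsub \<rho> u) N \<Longrightarrow> wsub \<rho> b = apow N \<Longrightarrow> holds \<rho> (transport u b)"
  by (simp add: holds_def transport_def pushesD)

lemma holds_commute: "wsub \<rho> u @ wsub \<rho> v = wsub \<rho> v @ wsub \<rho> u \<Longrightarrow> holds \<rho> (commute u v)"
  by (simp add: holds_def commute_def geq_refl)

lemma holds_copies:
  assumes "\<rho> x = spow m" "\<rho> y = wpow [(False, T)] m" "\<rho> z = wpow [(False, S), (False, T)] m"
    "\<rho> b = apow ((P * Q) ^ m)"
  shows "list_all (holds \<rho>) (copies x y z b)"
  using assms pushes_wpow[OF pushes_ST, of m] wpow_commute[of "[(False, S), (False, T)]" m]
    pushes_append[OF pushes_wpow[OF pushes_S, of m] pushes_wpow[OF pushes_T, of m]]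
    wpow_commute[of "[(False, T)]" m]
  by (auto simp: copies_def power_mult_distrib intro!: holds_commute
      holds_transport[where N = "P ^ m * Q ^ m"])

lemma holds_is_num: "\<rho> (Num x) = spow n \<Longrightarrow> holds \<rho> (is_num x)"
  using wpow_commute[of "[(False, S)]" n] by (auto simp: is_num_def intro!: holds_commute)

text \<open>Commuting with \<open>t\<close> or with \<open>s t\<close> fixes the direction of the
  pair of exponent sums by \<open>heis_commute\<close>, and the common conjugate \<open>b\<close>
  fixes the length. The translation part of \<open>z\<close> vanishes because 0 is the only fixed
  point of the action of \<open>s t\<close>, multiplication by \<open>e\<close>.\<close>

lemma copies_sound:
  assumes "list_all (holds \<rho>) (copies x y z b)" and x: "et (\<rho> x) = 0"
  shows "es (\<rho> y) = 0" "et (\<rho> y) = es (\<rho> x)" "es (\<rho> z) = es (\<rho> x)" "et (\<rho> z) = es (\<rho> x)"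
    "tr (\<rho> z) = 0"
proof -
  have h: "\<rho> y @ [(False, T)] \<approx> [(False, T)] @ \<rho> y"
    "\<rho> z @ [(False, S), (False, T)] \<approx> [(False, S), (False, T)] @ \<rho> z"
    "\<rho> z @ [(False, A)] \<approx> \<rho> b @ \<rho> z"
    "(\<rho> x @ \<rho> y) @ [(False, A)] \<approx> \<rho> b @ (\<rho> x @ \<rho> y)"
    using assms(1) by (auto simp: copies_def holds_def commute_def transport_def)
  show y: "es (\<rho> y) = 0" using heis_commute[OF h(1)] by simp
  have "es (\<rho> z) = et (\<rho> z)" using heis_commute[OF h(2)] by simp
  then show "et (\<rho> y) = es (\<rho> x)" "es (\<rho> z) = es (\<rho> x)" "et (\<rho> z) = es (\<rho> x)"
    using same_conj_imp[OF h(3,4)] x y by auto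
  have "tr (\<rho> z) = p * (q * tr (\<rho> z))"
    using geq_rep[OF h(2)] by simp
  then have "(of_int e - 1) * tr (\<rho> z) = 0"
    by (simp add: e_def algebra_simps)
  then show "tr (\<rho> z) = 0" using e_ge by (auto simp flip: of_int_diff)
qed

text \<open>The same argument with \<open>s\<close>, which acts as multiplication by
  \<open>p\<close>.\<close>

lemma is_num_sound:
  assumes "holds \<rho> (is_num x)"
  shows "et (\<rho> (Num x)) = 0" "tr (\<rho> (Num x)) = 0"
proof -
  have h: "\<rho> (Num x) @ [(False, S)] \<approx> [(False, S)] @ \<rho> (Num x)"
    using assms by (simp add: holds_def is_num_def commute_def)
  show "et (\<rho> (Num x)) = 0" using heis_commute[OF h] by simp
  have "(of_int p - 1) * tr (\<rho> (Num x)) = 0" using geq_rep[OF h] by (simp add: algebra_simps)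
  then show "tr (\<rho> (Num x)) = 0" using p_ge by (auto simp flip: of_int_diff)
qed

text \<open>Solutions are built from natural values, but a given solution only yields integers;
  hence two notions of satisfaction. For \<open>IsExp\<close>, \<open>zsat\<close> is conditional
  since the values of \<open>k\<close> and \<open>m\<close> are guaranteed by other atoms.\<close>

fun nsat :: "('n \<Rightarrow> nat) \<Rightarrow> 'n atom \<Rightarrow> bool" where
  "nsat v (IsOne x) \<longleftrightarrow> v x = 1"
| "nsat v (IsSum x y z) \<longleftrightarrow> v x + v y = v z"
| "nsat v (IsProd x y z) \<longleftrightarrow> v x * v y = v z"
| "nsat v (IsExp n y k m) \<longleftrightarrow> v y = P ^ v n \<and> v k = v y * v y + v n * v n + 1 \<and> v m = v k * v y"

fun zsat :: "('n \<Rightarrow> int) \<Rightarrow> 'n atom \<Rightarrow> bool" where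
  "zsat v (IsOne x) \<longleftrightarrow> v x = 1"
| "zsat v (IsSum x y z) \<longleftrightarrow> v x + v y = v z"
| "zsat v (IsProd x y z) \<longleftrightarrow> v x * v y = v z"
| "zsat v (IsExp n y k m) \<longleftrightarrow>
    (v k = v y * v y + v n * v n + 1 \<longrightarrow> v m = v k * v y \<longrightarrow> 0 \<le> v n \<and> v y = p ^ nat (v n))"

text \<open>Every summand is 1 modulo \<open>x - 1\<close>. The quotient \<open>j\<close> is needed
  as a natural number, since it becomes the exponent of the witness \<open>a^j\<close>.\<close>

lemma geometric_sum_mod: "x \<ge> 1 \<Longrightarrow> \<exists>j. (\<Sum>i<y. x ^ i) = y + j * (x - 1)" for x y :: nat
proof (induction y)
  case (Suc y)
  then obtain j where j: "(\<Sum>i<y. x ^ i) = y + j * (x - 1)" by blast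
  have "[x ^ y = 1 ^ y] (mod (x - 1))"
    using Suc.prems by (intro cong_pow) (simp add: cong_altdef_nat)
  then have "(x - 1) dvd (x ^ y - 1)"
    using Suc.prems by (simp add: cong_altdef_nat)
  then obtain c where "x ^ y - 1 = (x - 1) * c" by (elim dvdE)
  then have "x ^ y = 1 + c * (x - 1)"
    using Suc.prems by (simp add: mult.commute) (metis One_nat_def Suc_diff_1 nat_zero_less_power_iff zero_less_iff_neq_zero not_one_le_zero)
  then have "(\<Sum>i<Suc y. x ^ i) = Suc y + (j + c) * (x - 1)" using j by (simp add: add_mult_distrib)
  then show ?case by blast
qed simp

text \<open>Each \<open>w\<close> is moved to the right past the powers of \<open>a\<close>; the
  exponents add up to a geometric sum.\<close>

lemma power_apow_append:
  assumes "pushes w N"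
  shows "wpow ([(False, A)] @ w) y \<approx> apow (\<Sum>i<y. N ^ i) @ wpow w y"
proof (induction y)
  case (Suc y)
  have sum: "(\<Sum>i<Suc y. N ^ i) = 1 + N * (\<Sum>i<y. N ^ i)"
    by (simp add: sum.lessThan_Suc_shift sum_distrib_left del: sum.lessThan_Suc)
  have "([(False, A)] @ w) @ wpow ([(False, A)] @ w) y
      \<approx> ([(False, A)] @ w) @ (apow (\<Sum>i<y. N ^ i) @ wpow w y)"
    by (rule geq_append[OF geq_refl Suc])
  moreover have "[(False, A)] @ (w @ apow (\<Sum>i<y. N ^ i)) @ wpow w y
     \<approx> [(False, A)] @ (apow (N * (\<Sum>i<y. N ^ i)) @ w) @ wpow w y"
    by (intro geq_append[OF geq_refl geq_append[OF assms[unfolded pushes_def, rule_format] geq_refl]])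
  ultimately show ?case unfolding sum by (auto intro: geq_trans simp: wpow_add)
qed (simp add: geq_refl)

text \<open>The values \<open>\<tau>\<close> are chosen before \<open>\<rho>\<close>, from
  \<open>v\<close> and \<open>a\<close> alone, so that a single \<open>\<rho>\<close> can serve all
  atoms.\<close>

lemma atom_complete:
  assumes "nsat v a"
  shows "\<exists>\<tau>. \<forall>\<rho>. (\<forall>x. \<rho> (Num x) = spow (v x)) \<longrightarrow> (\<forall>j. \<rho> (Aux a j) = \<tau> j)
     \<longrightarrow> list_all (holds \<rho>) (atom_eqs a)"
proof (cases a)
  case (IsOne x)
  then show ?thesis using assms by (auto simp: holds_def geq_refl)
next
  case (IsSum x y z)
  then show ?thesis using assms
    by (auto simp: holds_is_num, auto simp: holds_def geq_refl simp flip: wpow_add)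
next
  case (IsProd n m k)
  \<comment> \<open>\<open>N\<close> is the power to which \<open>W\<close> raises \<open>a\<close>;
    as \<open>n m = k\<close>, the word \<open>s^k t^m\<close> raises \<open>a\<close> to the same
    power.\<close>
  define W where "W = wpow (spow (v n) @ [(False, T)]) (v m)"
  define N where "N = (P ^ v n * Q) ^ v m"
  define \<tau> where "\<tau> = (!) [wpow [(False, T)] (v m), [],
      apow ((P * Q) ^ v m), W, apow N, wpow [(False, S), (False, T)] (v m)]"
  have \<tau>: "\<tau> 0 = wpow [(False, T)] (v m)" "\<tau> 2 = apow ((P * Q) ^ v m)" "\<tau> 3 = W" "\<tau> 4 = apow N"
    "\<tau> 5 = wpow [(False, S), (False, T)] (v m)" by (simp_all add: \<tau>_def)
  have W: "pushes W N" unfolding W_def N_def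
    by (intro pushes_wpow pushes_append pushes_S pushes_T)
  have kY: "pushes (spow (v k) @ wpow [(False, T)] (v m)) N"
  proof -
    have "N = P ^ v k * Q ^ v m"
      using assms by (simp add: IsProd N_def power_mult_distrib flip: power_mult)
    then show ?thesis by (auto intro!: pushes_wpow pushes_append pushes_S pushes_T)
  qed
  have com: "W @ spow (v n) @ [(False, T)] = spow (v n) @ (False, T) # W"
    using wpow_commute[of "spow (v n) @ [(False, T)]" "v m"] by (simp add: W_def)
  have "list_all (holds \<rho>) (atom_eqs a)"
    if \<rho>: "\<forall>x. \<rho> (Num x) = spow (v x)" "\<forall>j. \<rho> (Aux a j) = \<tau> j" for \<rho>
  proof -
    have "list_all (holds \<rho>) (copies (Num m) (Aux a 0) (Aux a 5) (Aux a 2))"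
      by (rule holds_copies[where m = "v m"]) (simp_all add: \<rho> \<tau>)
    moreover have "holds \<rho> (is_num x)" for x using \<rho>(1) by (simp add: holds_is_num)
    moreover have "holds \<rho> (commute [Inr (Aux a 3)] [Inr (Num n), Inl T])"
      by (rule holds_commute) (simp add: \<rho> \<tau> com)
    moreover have "holds \<rho> (transport [Inr (Aux a 3)] [Inr (Aux a 4)])"
      by (rule holds_transport[where N = N]) (simp_all add: \<rho> \<tau> W)
    moreover have "holds \<rho> (transport [Inr (Num k), Inr (Aux a 0)] [Inr (Aux a 4)])"
      by (rule holds_transport[where N = N]) (simp_all add: \<rho> \<tau> kY)
    ultimately show ?thesis by (simp add: IsProd Let_def)
  qed
  then show ?thesis by blast
next
  case (IsExp n y k m)
  define E where "E = P * Q"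
  have E1: "E \<ge> 1" using p_ge q_ge by (simp add: E_def Suc_le_eq)
  have vs: "v y = P ^ v n" "v m = v k * v y" using assms by (auto simp: IsExp)
  define Z1 Z2 where "Z1 = wpow [(False, S), (False, T)] (v k)"
    and "Z2 = wpow [(False, S), (False, T)] (v m)"
  define V where "V = wpow ([(False, A)] @ Z1) (v y)"
  \<comment> \<open>The translation in \<open>V\<close> has length \<open>v y + d\<close> with
    \<open>d\<close> a multiple of \<open>E ^ v k - 1\<close>, and \<open>a^d\<close> is the
    commutator of \<open>Z1\<close> and \<open>a^j\<close>.\<close>
  obtain j where j: "(\<Sum>i<v y. (E ^ v k) ^ i) = v y + j * (E ^ v k - 1)"
    using geometric_sum_mod[of "E ^ v k" "v y"] E1 by auto
  define d where "d = j * (E ^ v k - 1)"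
  have dj: "E ^ v k * j = d + j" using E1 by (cases "E ^ v k") (auto simp: d_def)
  define \<tau> where "\<tau> = (!) [wpow [(False, T)] (v k), [], apow (E ^ v k),
     wpow [(False, T)] (v m), Z2, apow (E ^ v m), V, apow j, apow d, apow (v y), Z1]"
  have \<tau>: "\<tau> 0 = wpow [(False, T)] (v k)" "\<tau> 2 = apow (E ^ v k)" "\<tau> 3 = wpow [(False, T)] (v m)"
    "\<tau> 10 = Z1" "\<tau> 4 = Z2" "\<tau> 5 = apow (E ^ v m)" "\<tau> 6 = V" "\<tau> 7 = apow j" "\<tau> 8 = apow d"
    "\<tau> 9 = apow (v y)" by (simp_all add: \<tau>_def)
  have pZ1: "pushes Z1 (E ^ v k)" unfolding Z1_def E_def by (intro pushes_wpow pushes_ST)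
  have pV: "pushes V (E ^ v m)"
    using pushes_wpow[OF pushes_append[OF pushes_A pZ1], of "v y"]
    by (simp add: V_def vs power_mult)
  have comV: "V @ (False, A) # Z1 = (False, A) # Z1 @ V"
    using wpow_commute[of "[(False, A)] @ Z1" "v y"] by (simp add: V_def)
  have comA: "apow j @ [(False, A)] = (False, A) # apow j"
    using wpow_commute[of "[(False, A)]" j] by simp
  have Z1C: "Z1 @ apow j \<approx> apow d @ apow j @ Z1"
    using pZ1[unfolded pushes_def, rule_format, of j] by (simp add: dj wpow_add)
  have GX: "apow (v y) @ spow (v n) \<approx> spow (v n) @ [(False, A)]"
    using pushesD[OF pushes_wpow[OF pushes_S]] by (simp add: vs geq_sym)
  have VZ: "V \<approx> apow (v y) @ apow d @ Z2"
    using power_apow_append[OF pZ1, of "v y"] unfolding j d_def[symmetric]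
    by (simp add: V_def Z1_def Z2_def vs(2) wpow_mult wpow_add)
  have "list_all (holds \<rho>) (atom_eqs a)"
    if \<rho>: "\<forall>x. \<rho> (Num x) = spow (v x)" "\<forall>j. \<rho> (Aux a j) = \<tau> j" for \<rho>
  proof -
    have "list_all (holds \<rho>) (copies (Num k) (Aux a 0) (Aux a 10) (Aux a 2))"
      by (rule holds_copies[where m = "v k"]) (simp_all add: \<rho> \<tau> Z1_def E_def)
    moreover have "list_all (holds \<rho>) (copies (Num m) (Aux a 3) (Aux a 4) (Aux a 5))"
      by (rule holds_copies[where m = "v m"]) (simp_all add: \<rho> \<tau> Z2_def E_def)
    moreover have "holds \<rho> (is_num x)" for x using \<rho>(1) by (simp add: holds_is_num)
    moreover have "holds \<rho> (commute [Inr (Aux a 6)] [Inl A, Inr (Aux a 10)])"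
      by (rule holds_commute) (simp add: \<rho> \<tau> comV)
    moreover have "holds \<rho> (transport [Inr (Aux a 6)] [Inr (Aux a 5)])"
      by (rule holds_transport[where N = "E ^ v m"]) (simp_all add: \<rho> \<tau> pV)
    moreover have "holds \<rho> (commute [Inr (Aux a 7)] [Inl A])"
      by (rule holds_commute) (simp add: \<rho> \<tau> comA)
    moreover have "holds \<rho> ([Inr (Aux a 10), Inr (Aux a 7)], [Inr (Aux a 8), Inr (Aux a 7), Inr (Aux a 10)])"
      "holds \<rho> ([Inr (Aux a 9), Inr (Num n)], [Inr (Num n), Inl A])"
      "holds \<rho> ([Inr (Aux a 6)], [Inr (Aux a 9), Inr (Aux a 8), Inr (Aux a 4)])"
      by (simp_all add: holds_def \<rho> \<tau> Z1C GX VZ)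
    ultimately show ?thesis by (simp add: IsExp Let_def)
  qed
  then show ?thesis by blast
qed

text \<open>Only the images under the two representations are used, since a solution need not
  consist of the intended words.\<close>

lemma atom_sound:
  assumes "list_all (holds \<rho>) (atom_eqs a)"
  shows "zsat (\<lambda>x. es (\<rho> (Num x))) a"
proof (cases a)
  case (IsOne x)
  then have "\<rho> (Num x) \<approx> [(False, S)]" using assms by (auto simp: holds_def)
  then show ?thesis using geq_rep[of "\<rho> (Num x)"] IsOne by fastforce
next
  case (IsSum x y z)
  then have "\<rho> (Num x) @ \<rho> (Num y) \<approx> \<rho> (Num z)" using assms by (auto simp: holds_def)
  from geq_rep[OF this] show ?thesis using IsSum by simp
next
  case (IsProd n m k)
  define X where "X j = \<rho> (Aux a j)" for j
  have h: "list_all (holds \<rho>) ([is_num n, is_num m, is_num k] @ copies (Num m) (Aux a 0) (Aux a 5) (Aux a 2) @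
     [commute [Inr (Aux a 3)] [Inr (Num n), Inl T],
      transport [Inr (Aux a 3)] [Inr (Aux a 4)], transport [Inr (Num k), Inr (Aux a 0)] [Inr (Aux a 4)]])"
    using assms by (simp add: IsProd Let_def)
  have num: "et (\<rho> (Num n)) = 0" "et (\<rho> (Num m)) = 0" "et (\<rho> (Num k)) = 0"
    using h by (simp_all add: is_num_sound(1))
  have "list_all (holds \<rho>) (copies (Num m) (Aux a 0) (Aux a 5) (Aux a 2))"
    using h by simp
  from copies_sound[OF this num(2)]
  have Y: "es (X 0) = 0" "et (X 0) = es (\<rho> (Num m))" by (auto simp: X_def)
  have W: "X 3 @ (\<rho> (Num n) @ [(False, T)]) \<approx> (\<rho> (Num n) @ [(False, T)]) @ X 3"
    and t1: "X 3 @ [(False, A)] \<approx> X 4 @ X 3"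
    and t2: "(\<rho> (Num k) @ X 0) @ [(False, A)] \<approx> X 4 @ (\<rho> (Num k) @ X 0)"
    using h by (simp_all add: holds_def transport_def commute_def X_def)
  \<comment> \<open>\<open>heis_commute\<close> yields \<open>es (X 3) = n * et (X 3)\<close>; the
    common conjugate of \<open>a\<close> yields \<open>es (X 3) = k\<close> and
    \<open>et (X 3) = m\<close>.\<close>
  show ?thesis
    using heis_commute[OF W] same_conj_imp[OF t1 t2] Y num by (simp add: IsProd)
next
  case (IsExp n y k m)
  define X where "X j = \<rho> (Aux a j)" for j
  have h: "list_all (holds \<rho>) ([is_num n, is_num y, is_num k, is_num m] @
     copies (Num k) (Aux a 0) (Aux a 10) (Aux a 2) @ copies (Num m) (Aux a 3) (Aux a 4) (Aux a 5) @
     [commute [Inr (Aux a 6)] [Inl A, Inr (Aux a 10)], transport [Inr (Aux a 6)] [Inr (Aux a 5)],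
      commute [Inr (Aux a 7)] [Inl A],
      ([Inr (Aux a 10), Inr (Aux a 7)], [Inr (Aux a 8), Inr (Aux a 7), Inr (Aux a 10)]),
      ([Inr (Aux a 9), Inr (Num n)], [Inr (Num n), Inl A]),
      ([Inr (Aux a 6)], [Inr (Aux a 9), Inr (Aux a 8), Inr (Aux a 4)])])"
    using assms by (simp add: IsExp Let_def)
  have num: "et (\<rho> (Num n)) = 0" "tr (\<rho> (Num n)) = 0"
    "et (\<rho> (Num k)) = 0" "et (\<rho> (Num m)) = 0"
    using h by (simp_all add: is_num_sound)
  let ?n = "es (\<rho> (Num n))" and ?y = "es (\<rho> (Num y))" and ?k = "es (\<rho> (Num k))" and ?m = "es (\<rho> (Num m))"
  have "list_all (holds \<rho>) (copies (Num k) (Aux a 0) (Aux a 10) (Aux a 2))"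
    and hm: "list_all (holds \<rho>) (copies (Num m) (Aux a 3) (Aux a 4) (Aux a 5))"
    using h by simp_all
  note Z1 = copies_sound[OF this(1) num(3), folded X_def]
  note Z2 = copies_sound[OF hm num(4), folded X_def]
  have VA: "X 6 @ ((False, A) # X 10) \<approx> ((False, A) # X 10) @ X 6"
    and t1: "X 6 @ [(False, A)] \<approx> X 5 @ X 6"
    and C: "X 7 @ [(False, A)] \<approx> [(False, A)] @ X 7"
    and D: "X 10 @ X 7 \<approx> X 8 @ X 7 @ X 10"
    and G: "X 9 @ \<rho> (Num n) \<approx> \<rho> (Num n) @ [(False, A)]"
    and V: "X 6 \<approx> X 9 @ X 8 @ X 4"
    using h by (simp_all add: holds_def transport_def commute_def X_def)
  have t2: "X 4 @ [(False, A)] \<approx> X 5 @ X 4"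
    using hm by (simp add: copies_def holds_def transport_def X_def)
  have deZ: "de (X 10) = of_int e powi ?k" "de (X 4) = of_int e powi ?m"
    using Z1 Z2 by (simp_all add: de_eq e_def power_int_mult_distrib)
  \<comment> \<open>\<open>X 6\<close> and \<open>X 4\<close> conjugate \<open>a\<close> to the same
    element \<open>X 5\<close>, so their linear parts agree.\<close>
  have deV: "de (X 6) = of_int e powi ?m"
    using same_conj_imp[OF t1 t2] deZ(2) by (simp add: de_eq)
  define b c where "b = tr (X 6)" and "c = tr (X 7)"
  \<comment> \<open>The translation parts of both sides of \<open>VA\<close> give
    \<open>b + e^m = 1 + e^k * b\<close>.\<close>
  have b1: "b * (of_int e powi ?k - 1) = of_int e powi ?m - 1"
    using geq_rep[OF VA] Z1(5) by (simp add: deV deZ b_def algebra_simps)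
  have C1: "de (X 7) = 1" using geq_rep[OF C] by simp
  have D1: "de (X 8) = 1" using geq_rep[OF D] C1 de_pos[of "X 10"] by simp
  have D2: "tr (X 8) = (of_int e powi ?k - 1) * c"
    using geq_rep[OF D] C1 Z1(5) D1 by (simp add: deZ c_def algebra_simps)
  have G1: "de (X 9) = 1" using geq_rep[OF G] de_pos[of "\<rho> (Num n)"] by simp
  have G2: "tr (X 9) = of_int p powi ?n"
    using geq_rep[OF G] num G1 by (simp add: de_eq)
  have b2: "b = of_int p powi ?n + (of_int e powi ?k - 1) * c"
    using geq_rep[OF V] Z2(5) D1 D2 G1 G2 by (simp add: b_def)
  obtain N where "c * of_int (e ^ N) \<in> \<int>" using tr_denominator c_def by blast
  then show ?thesis using exponent_determined[OF _ _ b1 b2] by (simp add: IsExp)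
qed

lemma subst_peq_word: "subst \<sigma> (peq_word E) \<approx> [] \<longleftrightarrow> holds (\<lambda>x. \<sigma> (to_nat x)) E"
  by (simp add: peq_word_def subst_append subst_inv_word subst_positive geq_append_inv_iff holds_def)

lemma subst_param_word: "subst \<sigma> (param_word r n) \<approx> [] \<longleftrightarrow> \<sigma> r \<approx> spow n"
proof -
  have "subst \<sigma> (replicate n (False, Inl S)) = spow n"
    by (induction n) (auto simp: subst_def)
  then have "subst \<sigma> (param_word r n) = inv_word (\<sigma> r) @ spow n"
    using subst_append[of \<sigma> "[(True, Inr r)]"] by (simp add: param_word_def subst_def)
  then show ?thesis by (simp add: geq_inv_append_iff)
qed

lemma atoms_system_complete:
  fixes as :: "('n::countable) atom list"
  assumes "\<forall>a \<in> set as. nsat v a"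
  shows "solvable p q (param_word (to_nat (Num x :: 'n gvar)) (v x) # atoms_system as)"
proof -
  have "\<forall>a. \<exists>\<tau>. a \<in> set as \<longrightarrow> (\<forall>\<rho>. (\<forall>x. \<rho> (Num x) = spow (v x)) \<longrightarrow> (\<forall>j. \<rho> (Aux a j) = \<tau> j)
     \<longrightarrow> list_all (holds \<rho>) (atom_eqs a))"
    using atom_complete assms by metis
  then obtain \<tau> where \<tau>: "\<And>a \<rho>. a \<in> set as \<Longrightarrow> (\<forall>x. \<rho> (Num x) = spow (v x)) \<Longrightarrow>
     (\<forall>j. \<rho> (Aux a j) = \<tau> a j) \<Longrightarrow> list_all (holds \<rho>) (atom_eqs a)"
    by metis
  define \<rho> where "\<rho> = case_gvar (\<lambda>x. spow (v x)) \<tau>"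
  define \<sigma> :: "nat \<Rightarrow> gen word" where "\<sigma> = (\<lambda>i. \<rho> (from_nat i))"
  have \<sigma>: "(\<lambda>x. \<sigma> (to_nat x)) = \<rho>" by (simp add: \<sigma>_def)
  have "list_all (holds \<rho>) (atom_eqs a)" if "a \<in> set as" for a
    by (rule \<tau>[OF that]) (auto simp: \<rho>_def)
  moreover have "\<sigma> (to_nat (Num x :: 'n gvar)) = spow (v x)" by (simp add: \<sigma>_def \<rho>_def)
  ultimately show ?thesis unfolding solvable_def
    by (intro exI[of _ \<sigma>])
      (auto simp: atoms_system_def subst_peq_word subst_param_word \<sigma> geq_refl list_all_iff)
qed

lemma atoms_system_sound:
  fixes as :: "('n::countable) atom list"
  assumes "solvable p q (param_word (to_nat (Num x :: 'n gvar)) n # atoms_system as)"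
  shows "\<exists>z. z x = int n \<and> (\<forall>a \<in> set as. zsat z a)"
proof -
  obtain \<sigma> where \<sigma>: "\<And>w. w \<in> set (atoms_system as) \<Longrightarrow> subst \<sigma> w \<approx> []"
    "\<sigma> (to_nat (Num x :: 'n gvar)) \<approx> spow n"
    using assms by (auto simp: solvable_def subst_param_word)
  define \<rho> where "\<rho> = (\<lambda>x :: 'n gvar. \<sigma> (to_nat x))"
  have "zsat (\<lambda>x. es (\<rho> (Num x))) a" if "a \<in> set as" for a
  proof (rule atom_sound, unfold list_all_iff, rule ballI)
    fix E assume "E \<in> set (atom_eqs a)"
    then have "subst \<sigma> (peq_word E) \<approx> []"
      using that by (intro \<sigma>(1)) (auto simp: atoms_system_def)
    then show "holds \<rho> E" by (simp add: subst_peq_word \<rho>_def)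
  qed
  moreover have "es (\<rho> (Num x)) = int n"
    using geq_rep[OF \<sigma>(2)] by (simp add: \<rho>_def)
  ultimately show ?thesis by (intro exI[of _ "\<lambda>x. es (\<rho> (Num x))"]) simp
qed

end

section \<open>Diophantine relations with powers of a fixed base\<close>

text \<open>Only powers of one fixed base are terms, because these are what \<open>IsExp\<close>
  provides; general powers are derived from them.\<close>

datatype tm = Vr nat | Cn nat | Pl tm tm | Tm tm tm | Pw tm

instance tm :: countable
  by countable_datatype

fun tsub :: "(nat \<Rightarrow> tm) \<Rightarrow> tm \<Rightarrow> tm" where
  "tsub \<theta> (Vr i) = \<theta> i"
| "tsub \<theta> (Cn c) = Cn c"
| "tsub \<theta> (Pl s t) = Pl (tsub \<theta> s) (tsub \<theta> t)"
| "tsub \<theta> (Tm s t) = Tm (tsub \<theta> s) (tsub \<theta> t)"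
| "tsub \<theta> (Pw t) = Pw (tsub \<theta> t)"

text \<open>The polynomial terms: unlike powers, they respect congruences of their
  arguments.\<close>

fun pure :: "tm \<Rightarrow> bool" where
  "pure (Vr i) = True"
| "pure (Cn c) = True"
| "pure (Pl s t) \<longleftrightarrow> pure s \<and> pure t"
| "pure (Tm s t) \<longleftrightarrow> pure s \<and> pure t"
| "pure (Pw t) = False"

text \<open>\<open>app k w v\<close> is the environment \<open>w 0, \<dots>, w (k - 1), v 0, v 1, \<dots>\<close>.\<close>
definition app :: "nat \<Rightarrow> (nat \<Rightarrow> 'a) \<Rightarrow> (nat \<Rightarrow> 'a) \<Rightarrow> nat \<Rightarrow> 'a" where
  "app k w v i = (if i < k then w i else v (i - k))"

lemma app_app: "app k w (app m u v) = app (k + m) (\<lambda>i. if i < k then w i else u (i - k)) v"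
  by (rule ext) (auto simp: app_def diff_diff_left add.commute)

locale pow_base =
  fixes b :: nat
  assumes b_ge: "b \<ge> 2"
begin

fun tmv :: "(nat \<Rightarrow> nat) \<Rightarrow> tm \<Rightarrow> nat" where
  "tmv v (Vr i) = v i"
| "tmv v (Cn c) = c"
| "tmv v (Pl s t) = tmv v s + tmv v t"
| "tmv v (Tm s t) = tmv v s * tmv v t"
| "tmv v (Pw t) = b ^ tmv v t"

lemma tmv_tsub: "tmv v (tsub \<theta> t) = tmv (\<lambda>i. tmv v (\<theta> i)) t"
  by (induction t) auto

lemma tmv_cong_mod:
  "pure t \<Longrightarrow> (\<And>i. [u i = v i] (mod m)) \<Longrightarrow> [tmv u t = tmv v t] (mod m)"
  by (induction t) (auto intro: cong_add cong_mult)

lemma tmv_mono: "pure t \<Longrightarrow> (\<And>i. u i \<le> v i) \<Longrightarrow> tmv u t \<le> tmv v t"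
  by (induction t) (auto intro: add_mono mult_mono)

definition esat :: "(nat \<Rightarrow> nat) \<Rightarrow> (tm \<times> tm) list \<Rightarrow> bool" where
  "esat v eqs \<longleftrightarrow> (\<forall>(l, r) \<in> set eqs. tmv v l = tmv v r)"

lemma esat_append: "esat v (eqs @ eqs') \<longleftrightarrow> esat v eqs \<and> esat v eqs'"
  by (auto simp: esat_def)

lemma esat_tsub:
  "esat v (map (\<lambda>(l, r). (tsub \<theta> l, tsub \<theta> r)) eqs) \<longleftrightarrow> esat (\<lambda>i. tmv v (\<theta> i)) eqs"
  by (auto simp: esat_def tmv_tsub)

definition dio :: "((nat \<Rightarrow> nat) \<Rightarrow> bool) \<Rightarrow> bool" where
  "dio R \<longleftrightarrow> (\<exists>eqs k. \<forall>v. R v \<longleftrightarrow> (\<exists>w. esat (app k w v) eqs))"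

definition tmf :: "((nat \<Rightarrow> nat) \<Rightarrow> nat) \<Rightarrow> bool" where
  "tmf f \<longleftrightarrow> (\<exists>t. \<forall>v. f v = tmv v t)"

section \<open>Closure properties of Diophantine relations\<close>

named_theorems dio_intros

lemma tmf_var [dio_intros]: "tmf (\<lambda>v. v i)"
  unfolding tmf_def by (rule exI[of _ "Vr i"]) simp

lemma tmf_const [dio_intros]: "tmf (\<lambda>v. c)"
  unfolding tmf_def by (rule exI[of _ "Cn c"]) simp

lemma tmf_add [dio_intros]: "tmf f \<Longrightarrow> tmf g \<Longrightarrow> tmf (\<lambda>v. f v + g v)"
  unfolding tmf_def by (metis tmv.simps(3))

lemma tmf_mult [dio_intros]: "tmf f \<Longrightarrow> tmf g \<Longrightarrow> tmf (\<lambda>v. f v * g v)"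
  unfolding tmf_def by (metis tmv.simps(4))

lemma tmf_pow_b [dio_intros]: "tmf f \<Longrightarrow> tmf (\<lambda>v. b ^ f v)"
  unfolding tmf_def by (metis tmv.simps(5))

lemma tmf_Suc [dio_intros]: "tmf f \<Longrightarrow> tmf (\<lambda>v. Suc (f v))"
  using tmf_add[OF _ tmf_const, of f 1] by simp

lemma tmf_tmv [dio_intros]:
  assumes "\<And>i. tmf (\<lambda>v. f v i)"
  shows "tmf (\<lambda>v. tmv (f v) t)"
  by (induction t) (auto intro: dio_intros assms)

lemma dio_eq [dio_intros]:
  assumes "tmf f" "tmf g"
  shows "dio (\<lambda>v. f v = g v)"
proof -
  obtain s t where "\<And>v. f v = tmv v s" "\<And>v. g v = tmv v t" using assms tmf_def by metis
  moreover have "app 0 w v = v" for w v :: "nat \<Rightarrow> nat" by (rule ext) (simp add: app_def)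
  ultimately show ?thesis unfolding dio_def
    by (intro exI[of _ "[(s, t)]"] exI[of _ 0]) (simp add: esat_def)
qed

lemma dio_conj [dio_intros]:
  assumes "dio R" "dio R'"
  shows "dio (\<lambda>v. R v \<and> R' v)"
proof -
  obtain eqs k where R: "\<And>v. R v \<longleftrightarrow> (\<exists>w. esat (app k w v) eqs)" using assms(1) dio_def by auto
  obtain eqs' k' where R': "\<And>v. R' v \<longleftrightarrow> (\<exists>w. esat (app k' w v) eqs')" using assms(2) dio_def by auto
  \<comment> \<open>The first \<open>k\<close> unknowns serve \<open>eqs\<close>, the next
    \<open>k'\<close> serve \<open>eqs'\<close>, and the arguments follow.\<close>
  let ?eqs = "map (\<lambda>(l, r). (tsub (\<lambda>i. Vr (if i < k then i else i + k')) l,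
       tsub (\<lambda>i. Vr (if i < k then i else i + k')) r)) eqs"
  let ?eqs' = "map (\<lambda>(l, r). (tsub (\<lambda>i. Vr (i + k)) l, tsub (\<lambda>i. Vr (i + k)) r)) eqs'"
  have 1: "(\<lambda>i. tmv (app (k + k') w v) (Vr (if i < k then i else i + k'))) = app k w v" for w v
    by (rule ext) (auto simp: app_def)
  have 2: "(\<lambda>i. tmv (app (k + k') w v) (Vr (i + k))) = app k' (\<lambda>i. w (i + k)) v" for w v
    by (rule ext) (auto simp: app_def add.commute)
  have "R v \<and> R' v \<longleftrightarrow> (\<exists>w. esat (app (k + k') w v) (?eqs @ ?eqs'))" for v
  proof
    assume "R v \<and> R' v"
    then obtain w w' where w: "esat (app k w v) eqs" "esat (app k' w' v) eqs'" using R R' by auto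
    let ?w = "\<lambda>i. if i < k then w i else w' (i - k)"
    have "app k ?w v = app k w v" "app k' (\<lambda>i. ?w (i + k)) v = app k' w' v"
      by (auto simp: app_def fun_eq_iff)
    then have "esat (app (k + k') ?w v) (?eqs @ ?eqs')"
      unfolding esat_append esat_tsub 1 2 using w by simp
    then show "\<exists>w. esat (app (k + k') w v) (?eqs @ ?eqs')" by blast
  next
    assume "\<exists>w. esat (app (k + k') w v) (?eqs @ ?eqs')"
    then show "R v \<and> R' v" unfolding esat_append esat_tsub 1 2 using R R' by blast
  qed
  then show ?thesis unfolding dio_def by blast
qed

lemma dio_ex_block:
  assumes "dio R"
  shows "dio (\<lambda>v. \<exists>u. R (app m u v))"
proof -
  obtain eqs k where R: "\<And>v. R v \<longleftrightarrow> (\<exists>w. esat (app k w v) eqs)" using assms dio_def by auto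
  have "(\<exists>u. R (app m u v)) \<longleftrightarrow> (\<exists>w. esat (app (k + m) w v) eqs)" for v
  proof
    assume "\<exists>u. R (app m u v)"
    then show "\<exists>w. esat (app (k + m) w v) eqs" unfolding R app_app by blast
  next
    assume "\<exists>w. esat (app (k + m) w v) eqs"
    then obtain w where "esat (app (k + m) w v) eqs" by blast
    moreover have "(\<lambda>i. if i < k then w i else w (i - k + k)) = w" by (rule ext) auto
    ultimately have "esat (app k w (app m (\<lambda>i. w (i + k)) v)) eqs"
      unfolding app_app by simp
    then show "\<exists>u. R (app m u v)" unfolding R by blast
  qed
  then show ?thesis unfolding dio_def by blast
qed

text \<open>In de Bruijn style: the bound variable becomes variable 0 and all others move up by
  one.\<close>

lemma dio_ex [dio_intros]:
  assumes "dio (\<lambda>v. R (\<lambda>i. v (Suc i)) (v 0))"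
  shows "dio (\<lambda>v. \<exists>x. R v x)"
proof -
  have "(\<lambda>i. app 1 u v (Suc i)) = v" "app 1 u v 0 = u 0" for u v :: "nat \<Rightarrow> nat"
    by (auto simp: app_def)
  then have "(\<exists>u. R (\<lambda>i. app 1 u v (Suc i)) (app 1 u v 0)) \<longleftrightarrow> (\<exists>x. R v x)" for v
    by auto
  then show ?thesis using dio_ex_block[OF assms, of 1] by simp
qed

lemma dio_comp:
  assumes "dio R" "\<And>i. tmf (f i)"
  shows "dio (\<lambda>v. R (\<lambda>i. f i v))"
proof -
  obtain eqs k where R: "\<And>v. R v \<longleftrightarrow> (\<exists>w. esat (app k w v) eqs)" using assms dio_def by auto
  obtain \<theta> where \<theta>: "\<And>i v. f i v = tmv v (\<theta> i)" using assms(2) unfolding tmf_def by metis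
  let ?\<eta> = "\<lambda>i. if i < k then Vr i else tsub (\<lambda>j. Vr (j + k)) (\<theta> (i - k))"
  have "(\<lambda>i. tmv (app k w v) (?\<eta> i)) = app k w (\<lambda>i. f i v)" for w v
    by (rule ext) (auto simp: app_def \<theta> tmv_tsub)
  then have "R (\<lambda>i. f i v) \<longleftrightarrow>
      (\<exists>w. esat (app k w v) (map (\<lambda>(l, r). (tsub ?\<eta> l, tsub ?\<eta> r)) eqs))" for v
    unfolding esat_tsub R by simp
  then show ?thesis unfolding dio_def by blast
qed

lemma dio_iff: "(\<And>v. R v \<longleftrightarrow> R' v) \<Longrightarrow> dio R' \<Longrightarrow> dio R"
  by (simp add: dio_def)

text \<open>Reduces a relation between terms to the same relation between variables, so that a
  defining formula with quantifiers need only be treated once.\<close>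

lemma dio_comp2:
  assumes "dio (\<lambda>v. R (v 0) (v 1))" "tmf f" "tmf g"
  shows "dio (\<lambda>v. R (f v) (g v))"
  using dio_comp[OF assms(1), of "\<lambda>i. if i = 0 then f else g"] assms(2,3) by simp

lemma dio_comp3:
  assumes "dio (\<lambda>v. R (v 0) (v 1) (v 2))" "tmf f" "tmf g" "tmf h"
  shows "dio (\<lambda>v. R (f v) (g v) (h v))"
  using dio_comp[OF assms(1), of "\<lambda>i. if i = 0 then f else if i = 1 then g else h"] assms(2-4)
  by simp

lemma dio_True: "dio (\<lambda>v. True)"
  using dio_eq[OF tmf_const tmf_const, of 0 0] by simp

lemma dio_all_less:
  fixes m :: nat
  assumes "\<And>j. j < m \<Longrightarrow> dio (R j)"
  shows "dio (\<lambda>v. \<forall>j<m. R j v)"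
  using assms
proof (induction m)
  case (Suc m)
  then have "dio (\<lambda>v. R m v \<and> (\<forall>j<m. R j v))" by (intro dio_conj) auto
  moreover have "(\<lambda>v. \<forall>j<Suc m. R j v) = (\<lambda>v. R m v \<and> (\<forall>j<m. R j v))"
    by (auto simp: less_Suc_eq)
  ultimately show ?case by simp
qed (simp add: dio_True)

lemma dio_less [dio_intros]: "tmf f \<Longrightarrow> tmf g \<Longrightarrow> dio (\<lambda>v. f v < g v)"
proof (rule dio_comp2)
  have "dio (\<lambda>v. \<exists>x. v 0 + x + 1 = v 1)" by (intro dio_intros)
  moreover have "(\<exists>x. m + x + 1 = n) \<longleftrightarrow> m < n" for m n :: nat by presburger
  ultimately show "dio (\<lambda>v. v 0 < v 1)" by simp
qed

lemma dio_dvd [dio_intros]: "tmf f \<Longrightarrow> tmf g \<Longrightarrow> dio (\<lambda>v. f v dvd g v)"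
proof (rule dio_comp2)
  show "dio (\<lambda>v. v 0 dvd v 1)" unfolding dvd_def by (intro dio_intros)
qed

lemma dio_cong [dio_intros]: "tmf f \<Longrightarrow> tmf g \<Longrightarrow> tmf h \<Longrightarrow> dio (\<lambda>v. [f v = g v] (mod h v))"
proof (rule dio_comp3)
  show "dio (\<lambda>v. [v 0 = v 1] (mod v 2))" unfolding cong_iff_lin_nat by (intro dio_intros)
qed

section \<open>Powers, binomial coefficients and factorials\<close>

text \<open>With \<open>M = b^K - x\<close>, the power \<open>b^K\<close> is congruent to
  \<open>x\<close> modulo \<open>M\<close>, hence \<open>b^(K n)\<close> to \<open>x^n\<close>,
  which is smaller than \<open>M\<close>.\<close>

lemma power_characterization:
  "z = x ^ n \<longleftrightarrow> (\<exists>K M. K = n * x + x + 1 \<and> M + x = b ^ K \<and> z < M \<and> [z = b ^ (K * n)] (mod M))"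
proof -
  \<comment> \<open>Large enough for \<open>x ^ n + x < b ^ K\<close>, by
    \<open>x < 2 ^ x\<close>.\<close>
  define K where "K = n * x + x + 1"
  have "x ^ n \<le> (2 ^ x) ^ n" by (intro power_mono) (auto simp: less_imp_le)
  then have "x ^ n \<le> 2 ^ (n * x)" by (simp add: power_mult[symmetric] mult.commute)
  moreover have "x < 2 ^ x" by simp
  ultimately have "x ^ n * 1 \<le> 2 ^ (n * x) * 2 ^ x" "1 * x < 2 ^ (n * x) * 2 ^ x"
    by (intro mult_mono; simp) (intro mult_le_less_imp_less; simp)
  then have "x ^ n + x < 2 ^ K" by (simp add: K_def power_add)
  also have "2 ^ K \<le> b ^ K" using b_ge by (intro power_mono) auto
  finally have lt: "x ^ n + x < b ^ K" .
  define M where "M = b ^ K - x"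
  have Mx: "M + x = b ^ K" using lt by (simp add: M_def)
  have "[b ^ K = x] (mod M)" unfolding Mx[symmetric] by (simp add: cong_def)
  then have c: "[b ^ (K * n) = x ^ n] (mod M)" unfolding power_mult by (rule cong_pow)
  have xM: "x ^ n < M" using lt by (simp add: M_def)
  show ?thesis
  proof
    assume "z = x ^ n"
    then show "\<exists>K M. K = n * x + x + 1 \<and> M + x = b ^ K \<and> z < M \<and> [z = b ^ (K * n)] (mod M)"
      using c xM Mx K_def cong_sym by blast
  next
    assume "\<exists>K M. K = n * x + x + 1 \<and> M + x = b ^ K \<and> z < M \<and> [z = b ^ (K * n)] (mod M)"
    then obtain K' M' where h: "K' = n * x + x + 1" "M' + x = b ^ K'" "z < M'" "[z = b ^ (K' * n)] (mod M')"
      by blast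
    then have "K' = K" "M' = M" using Mx by (auto simp: K_def)
    then have "[z = x ^ n] (mod M)" "z < M" using h c cong_trans by auto
    then show "z = x ^ n" using xM cong_less_modulus_unique_nat by blast
  qed
qed

lemma dio_power [dio_intros]: "tmf f \<Longrightarrow> tmf g \<Longrightarrow> tmf h \<Longrightarrow> dio (\<lambda>v. f v = g v ^ h v)"
  by (rule dio_comp3[where R = "\<lambda>x y z. x = y ^ z"], rule dio_iff[OF power_characterization])
    (intro dio_intros)

lemma digits_less:
  fixes X :: nat
  assumes "\<And>i. d i < X"
  shows "(\<Sum>i<k. d i * X ^ i) < X ^ k"
proof (induction k)
  case (Suc k)
  have "(\<Sum>i<Suc k. d i * X ^ i) < X ^ k + d k * X ^ k" using Suc by simp
  also have "\<dots> = Suc (d k) * X ^ k" by simp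
  also have "\<dots> \<le> X * X ^ k" using assms[of k] by (intro mult_right_mono) auto
  finally show ?case by simp
qed simp

lemma sum_lessThan_add:
  "(\<Sum>i<m + n. f i) = (\<Sum>i<m. f i) + (\<Sum>i<n. f (m + i))" for f :: "nat \<Rightarrow> nat"
  by (induction n) auto

text \<open>The binomial coefficients \<open>n choose i\<close> are the digits of
  \<open>(1 + X)^n\<close> in base \<open>X = b^(n + 1) > 2^n\<close>. Here \<open>D\<close>
  collects the digits below position \<open>k\<close> and \<open>E\<close> those above.\<close>

lemma binomial_characterization:
  "c = n choose k \<longleftrightarrow> (\<exists>X Y D E. X = b ^ (n + 1) \<and> Y = (1 + X) ^ n \<and>
     Y = E * X * b ^ ((n + 1) * k) + c * b ^ ((n + 1) * k) + D \<and> D < b ^ ((n + 1) * k) \<and> c < X)"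
proof -
  define X where "X = b ^ (n + 1)"
  have Xk: "b ^ ((n + 1) * k) = X ^ k" unfolding X_def by (rule power_mult)
  have "(2::nat) ^ n < 2 ^ (n + 1)" by simp
  also have "\<dots> \<le> X" unfolding X_def using b_ge by (intro power_mono) auto
  finally have X: "n choose i < X" for i using binomial_le_pow2[of n i] by simp
  have X0: "X > 0" using X[of 0] by simp
  define D E where "D = (\<Sum>i<k. (n choose i) * X ^ i)" and "E = (\<Sum>i<n. (n choose (k + 1 + i)) * X ^ i)"
  have "(1 + X) ^ n = (\<Sum>i\<le>n. (n choose i) * X ^ i)"
    using binomial_ring[of X 1 n] by (simp add: add.commute)
  \<comment> \<open>The added coefficients vanish; the longer range reaches position
    \<open>k\<close> even if \<open>k > n\<close>.\<close>
  also have "\<dots> = (\<Sum>i<k + 1 + n. (n choose i) * X ^ i)"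
    by (rule sum.mono_neutral_left) auto
  also have "\<dots> = (\<Sum>i<k + 1. (n choose i) * X ^ i) + (\<Sum>i<n. (n choose (k + 1 + i)) * X ^ (k + 1 + i))"
    by (rule sum_lessThan_add)
  also have "(\<Sum>i<n. (n choose (k + 1 + i)) * X ^ (k + 1 + i)) = E * (X * X ^ k)"
    unfolding E_def sum_distrib_right by (intro sum.cong) (auto simp: power_add)
  also have "(\<Sum>i<k + 1. (n choose i) * X ^ i) + E * (X * X ^ k) =
      E * X * X ^ k + (n choose k) * X ^ k + D"
    by (simp add: D_def)
  finally have Y: "(1 + X) ^ n = E * X * X ^ k + (n choose k) * X ^ k + D" .
  have DX: "D < X ^ k" unfolding D_def by (rule digits_less[OF X])
  have digit: "(E' * X * X ^ k + c' * X ^ k + D') div X ^ k mod X = c'"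
    if "D' < X ^ k" "c' < X" for E' c' D'
  proof -
    have "E' * X * X ^ k + c' * X ^ k + D' = (E' * X + c') * X ^ k + D'" by (simp add: algebra_simps)
    moreover have "((E' * X + c') * X ^ k + D') div X ^ k = E' * X + c'"
      using that X0 by (simp add: div_mult_self3)
    ultimately show ?thesis using that by simp
  qed
  show ?thesis
  proof
    assume "c = n choose k"
    then show "\<exists>X Y D E. X = b ^ (n + 1) \<and> Y = (1 + X) ^ n \<and>
     Y = E * X * b ^ ((n + 1) * k) + c * b ^ ((n + 1) * k) + D \<and> D < b ^ ((n + 1) * k) \<and> c < X"
      unfolding Xk using Y DX X X_def by blast
  next
    assume "\<exists>X Y D E. X = b ^ (n + 1) \<and> Y = (1 + X) ^ n \<and>
     Y = E * X * b ^ ((n + 1) * k) + c * b ^ ((n + 1) * k) + D \<and> D < b ^ ((n + 1) * k) \<and> c < X"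
    then obtain D' E' where "(1 + X) ^ n = E' * X * X ^ k + c * X ^ k + D'" "D' < X ^ k" "c < X"
      unfolding Xk X_def[symmetric] by blast
    then show "c = n choose k" using digit Y DX X by metis
  qed
qed

lemma dio_binomial [dio_intros]: "tmf f \<Longrightarrow> tmf g \<Longrightarrow> tmf h \<Longrightarrow> dio (\<lambda>v. f v = (g v choose h v))"
  by (rule dio_comp3[where R = "\<lambda>x y z. x = (y choose z)"], rule dio_iff[OF binomial_characterization])
    (intro dio_power dio_intros)

text \<open>The falling factorial. Truncated subtraction is harmless: for \<open>k > n\<close> both
  sides are 0, on the right through the factor \<open>n - n\<close>.\<close>

lemma fact_mult_binomial: "fact k * (n choose k) = (\<Prod>i<k. n - i)" for n k :: nat
proof (induction k)
  case (Suc k)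
  have "fact (Suc k) * (n choose Suc k) = fact k * (Suc k * (n choose Suc k))"
    by (simp add: algebra_simps)
  also have "Suc k * (n choose Suc k) = (n - k) * (n choose k)"
    by (simp only: binomial_absorption binomial_absorb_comp)
  finally show ?case using Suc by (simp add: algebra_simps)
qed simp

text \<open>A form without division of the estimate that the product of the \<open>1 - i / r\<close>
  is at least \<open>1 - m * m / r\<close>.\<close>

lemma falling_product_bound:
  fixes r :: int
  assumes "int m \<le> r"
  shows "r ^ m * (r - int m * int m) \<le> r * (\<Prod>i<m. r - int i)"
  using assms
proof (induction m)
  case (Suc m)
  have "r ^ Suc m * (r - int (Suc m) * int (Suc m)) \<le> r ^ m * ((r - int m * int m) * (r - int m))"
  proof -
    have "(r - int m * int m) * (r - int m) - r * (r - int (Suc m) * int (Suc m))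
        = r * (int m + 1) + int m * int m * int m"
      by (simp add: algebra_simps)
    also have "\<dots> \<ge> 0" using Suc.prems by simp
    finally have "r * (r - int (Suc m) * int (Suc m)) \<le> (r - int m * int m) * (r - int m)" by simp
    then show ?thesis using Suc.prems mult_left_mono[of _ _ "r ^ m"] by (simp add: mult_ac)
  qed
  also have "\<dots> = (r ^ m * (r - int m * int m)) * (r - int m)" by simp
  also have "\<dots> \<le> (r * (\<Prod>i<m. r - int i)) * (r - int m)"
    using Suc by (intro mult_right_mono) auto
  finally show ?case by simp
qed simp

text \<open>For large \<open>r\<close>, the quotient \<open>r^n / (r choose n)\<close> lies between
  \<open>n!\<close> and \<open>n! + 1\<close>, so \<open>n!\<close> is its integer part.\<close>

lemma fact_characterization:
  "f = fact n \<longleftrightarrow> (\<exists>e r c x D. e = n ^ n \<and> r = n * n * (e + 1) + n + 1 \<and> c = (r choose n) \<and> x = r ^ n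
      \<and> x = f * c + D \<and> D < c)"
proof -
  \<comment> \<open>\<open>n ^ n\<close> is an expressible upper bound for \<open>fact n\<close>;
    what is needed is \<open>r > n * n * (fact n + 1)\<close>.\<close>
  define r where "r = n * n * (n ^ n + 1) + n + 1"
  define c where "c = (r choose n)"
  have rn: "n \<le> r" by (simp add: r_def)
  have prod: "fact n * int c = (\<Prod>i<n. int r - int i)"
  proof -
    have "fact n * int c = int (\<Prod>i<n. r - i)" unfolding fact_mult_binomial[symmetric] c_def by simp
    also have "\<dots> = (\<Prod>i<n. int r - int i)"
      using rn by (auto simp: of_nat_diff intro!: prod.cong)
    finally show ?thesis .
  qed
  have le: "fact n * c \<le> r ^ n"
    unfolding c_def fact_mult_binomial using prod_mono[of "{..<n}" "\<lambda>i. r - i" "\<lambda>i. r"] by simp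
  have "(fact n :: nat) \<le> n ^ n" using fact_le_power[of n, where ?'a = nat] by simp
  then have "n * n * (fact n + 1) < r"
    using mult_le_mono2[of "fact n + 1" "n ^ n + 1" "n * n"] unfolding r_def by linarith
  then have "int (n * n * (fact n + 1)) < int r" by (simp only: of_nat_less_iff)
  then have "fact n * int r < (fact n + 1) * (int r - int n * int n)"
    by (simp add: algebra_simps)
  moreover have "r > 0" by (simp add: r_def)
  then have "int r ^ n > 0" by simp
  ultimately have "int r ^ n * (fact n * int r) < int r ^ n * ((fact n + 1) * (int r - int n * int n))"
    by (rule mult_strict_left_mono)
  also have "\<dots> = (fact n + 1) * (int r ^ n * (int r - int n * int n))" by simp
  also have "\<dots> \<le> (fact n + 1) * (int r * (fact n * int c))"
    unfolding prod using rn by (intro mult_left_mono falling_product_bound) auto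
  finally have "(fact n * int r) * int r ^ n < (fact n * int r) * ((fact n + 1) * int c)"
    by (simp add: mult_ac)
  then have "int r ^ n < (fact n + 1) * int c" by (rule mult_left_less_imp_less) simp
  then have "int (r ^ n) < int ((fact n + 1) * c)" by (simp add: algebra_simps)
  then have lt: "r ^ n < (fact n + 1) * c" by (simp only: of_nat_less_iff)
  define D where "D = r ^ n - fact n * c"
  have D: "r ^ n = fact n * c + D" "D < c" using le lt by (auto simp: D_def)
  show ?thesis
  proof
    assume "f = fact n"
    then show "\<exists>e r c x D. e = n ^ n \<and> r = n * n * (e + 1) + n + 1 \<and> c = (r choose n) \<and> x = r ^ n
      \<and> x = f * c + D \<and> D < c"
      using D c_def r_def by blast
  next
    assume "\<exists>e r c x D. e = n ^ n \<and> r = n * n * (e + 1) + n + 1 \<and> c = (r choose n) \<and> x = r ^ n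
      \<and> x = f * c + D \<and> D < c"
    then obtain D' where D': "r ^ n = f * c + D'" "D' < c" unfolding c_def r_def by blast
    have "f = r ^ n div c" using D' by simp
    also have "\<dots> = fact n" using D by simp
    finally show "f = fact n" .
  qed
qed

lemma dio_fact [dio_intros]: "tmf f \<Longrightarrow> tmf g \<Longrightarrow> dio (\<lambda>v. f v = fact (g v))"
  by (rule dio_comp2[where R = "\<lambda>x y. x = fact y"], rule dio_iff[OF fact_characterization])
    (intro dio_power dio_binomial dio_intros)

section \<open>A bounded quantifier expressed by a congruence\<close>

lemma app_le: "(\<And>i. u i \<le> u' i) \<Longrightarrow> app m u v i \<le> app m u' v i" for v :: "nat \<Rightarrow> nat"
  by (auto simp: app_def)

lemma app_cong_mod:
  fixes v :: "nat \<Rightarrow> nat"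
  assumes "\<And>j. j < m \<Longrightarrow> [u j = u' j] (mod q)"
  shows "[app m u v i = app m u' v i] (mod q)"
  using assms by (auto simp: app_def cong_def)

text \<open>Since \<open>(F!)\<^sup>2\<close> divides \<open>K + 1\<close>, the quotient \<open>(K + 1) / (k + 1)\<close> is a multiple of \<open>F!\<close>, and
  \<open>q k\<close> is its predecessor.\<close>
lemma binomial_factors:
  fixes K F y :: nat
  assumes dvd: "fact F * fact F dvd K + 1" and y: "y \<le> F" and F: "3 \<le> F"
  obtains q where "\<And>k. k < y \<Longrightarrow> K - k = (k + 1) * q k" "\<And>k. k < y \<Longrightarrow> k \<le> K"
    "\<And>k. k < y \<Longrightarrow> coprime (q k) (fact F)" "\<And>k. k < y \<Longrightarrow> q k > 1"
    "K choose y = (\<Prod>k<y. q k)" "\<And>k l. k < y \<Longrightarrow> l < y \<Longrightarrow> k \<noteq> l \<Longrightarrow> coprime (q k) (q l)"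
proof -
  have "\<exists>e. K + 1 = (k + 1) * e \<and> fact F dvd e" if "k < y" for k
  proof -
    have "k + 1 dvd (fact F :: nat)" using that y by (intro dvd_fact) auto
    then obtain c where c: "fact F = (k + 1) * c" by (elim dvdE)
    obtain d where d: "K + 1 = fact F * fact F * d" using dvd by (elim dvdE)
    have "K + 1 = (k + 1) * (fact F * (c * d))" unfolding d by (subst (1) c) (simp only: mult_ac)
    then show ?thesis by (intro exI[of _ "fact F * (c * d)"]) simp
  qed
  then obtain e where e: "\<And>k. k < y \<Longrightarrow> K + 1 = (k + 1) * e k" "\<And>k. k < y \<Longrightarrow> fact F dvd e k"
    by metis
  define q where "q k = e k - 1" for k
  have e_ge: "e k \<ge> 6" if "k < y" for k
  proof -
    have "e k \<noteq> 0" using e(1)[OF that] by (metis Suc_eq_plus1 mult_0_right nat.distinct(1))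
    then have "fact F \<le> e k" using e(2)[OF that] by (simp add: dvd_imp_le)
    moreover have "fact 3 \<le> (fact F :: nat)" using F by (rule fact_mono_nat)
    ultimately show ?thesis by (simp add: fact_numeral)
  qed
  have eq: "e k = q k + 1" if "k < y" for k using e_ge[OF that] by (simp add: q_def)
  have Kk: "K = k + (k + 1) * q k" if "k < y" for k
    using e(1)[OF that] eq[OF that] by simp
  have 1: "K - k = (k + 1) * q k" if "k < y" for k
    using Kk[OF that] by simp
  have 2: "k \<le> K" if "k < y" for k using Kk[OF that] by simp
  have 3: "coprime (q k) (fact F)" if "k < y" for k
  proof -
    have "coprime (q k) (q k + 1)" by simp
    then show ?thesis using e(2)[OF that] unfolding eq[OF that]
      by (meson coprime_divisors dvd_refl)
  qed
  have 4: "q k > 1" if "k < y" for k using e_ge[OF that] by (simp add: q_def)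
  have "fact y * (K choose y) = (\<Prod>k<y. (k + 1) * q k)"
    unfolding fact_mult_binomial using 1 by (intro prod.cong) auto
  also have "\<dots> = fact y * (\<Prod>k<y. q k)"
    unfolding prod.distrib by (simp add: fact_prod_Suc lessThan_atLeast0)
  finally have 5: "K choose y = (\<Prod>k<y. q k)" by simp
  \<comment> \<open>A common divisor divides \<open>(K - k) - (K - l) = l - k\<close>, hence
    \<open>fact F\<close>, to which \<open>q k\<close> is coprime.\<close>
  have lt: "coprime (q k) (q l)" if "k < l" "l < y" for k l
  proof (rule coprimeI)
    fix g assume g: "g dvd q k" "g dvd q l"
    then have "g dvd K - k" "g dvd K - l" using 1 that by auto
    then have "g dvd (K - k) - (K - l)" by (rule dvd_diff_nat)
    also have "(K - k) - (K - l) = l - k" using 2[of l] that by simp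
    also have "l - k dvd fact F" using that y by (intro dvd_fact) auto
    finally show "g dvd 1" using g(1) 3[of k] that coprime_common_divisor by fastforce
  qed
  have 6: "coprime (q k) (q l)" if "k < y" "l < y" "k \<noteq> l" for k l
    using lt[of k l] lt[of l k] that by (cases "k < l") (auto simp: coprime_commute)
  show ?thesis by (rule that[of q]) (use 1 2 3 4 5 6 in auto)
qed

text \<open>The Chinese remainder theorem packs all witnesses into \<open>U\<close>, and
  \<open>K\<close> is congruent to \<open>k\<close> modulo \<open>q k\<close>, so the equations for
  all \<open>k < y\<close> merge into one congruence modulo \<open>N\<close>, the product of the
  \<open>q k\<close>. Divisibility of \<open>U j choose B\<close> encodes the bound on the residues.
  Conversely, a prime factor of \<open>q k\<close> exceeds both sides, which makes the congruence an
  equality.\<close>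

lemma bounded_quantifier_characterization:
  fixes v :: "nat \<Rightarrow> nat" and m y B :: nat and l r :: tm
  defines "L \<equiv> \<lambda>k u. tmv (app (Suc m) (case_nat k u) v) l"
    and "R \<equiv> \<lambda>k u. tmv (app (Suc m) (case_nat k u) v) r"
  assumes "pure l" "pure r"
  shows "(\<forall>k<y. \<exists>u. (\<forall>j<m. u j < B) \<and> L k u = R k u) \<longleftrightarrow>
    (\<exists>U K F f N. F = y + B + L y (\<lambda>_. B) + R y (\<lambda>_. B) + 3 \<and> f = fact F \<and> f * f dvd K + 1 \<and>
      N = (K choose y) \<and> [L K U = R K U] (mod N) \<and> (\<forall>j<m. \<exists>c. c = (U j choose B) \<and> N dvd c))"
proof
  assume "\<forall>k<y. \<exists>u. (\<forall>j<m. u j < B) \<and> L k u = R k u"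
  then obtain u where u: "\<And>k j. k < y \<Longrightarrow> j < m \<Longrightarrow> u k j < B" "\<And>k. k < y \<Longrightarrow> L k (u k) = R k (u k)"
    by metis
  \<comment> \<open>Polynomials are monotone, so \<open>F\<close> bounds both sides for all
    \<open>k < y\<close> and all witnesses below \<open>B\<close>. Also \<open>F \<ge> y\<close> and
    \<open>F \<ge> 3\<close> serve \<open>binomial_factors\<close>, and \<open>F \<ge> B\<close>
    makes \<open>q k\<close> coprime to \<open>fact B\<close>.\<close>
  define F where "F = y + B + L y (\<lambda>_. B) + R y (\<lambda>_. B) + 3"
  define K where "K = fact F * fact F - (1::nat)"
  have dvd: "fact F * fact F dvd K + 1" by (simp add: K_def)
  have "y \<le> F" "3 \<le> F" by (simp_all add: F_def)
  from binomial_factors[OF dvd this] obtain q where q: "\<And>k. k < y \<Longrightarrow> K - k = (k + 1) * q k"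
    "\<And>k. k < y \<Longrightarrow> k \<le> K" "\<And>k. k < y \<Longrightarrow> coprime (q k) (fact F)"
    "K choose y = (\<Prod>k<y. q k)" "\<And>k l. k < y \<Longrightarrow> l < y \<Longrightarrow> k \<noteq> l \<Longrightarrow> coprime (q k) (q l)"
    by metis
  have "\<exists>x. \<forall>k\<in>{..<y}. [x = u k j] (mod q k)" for j
    by (rule chinese_remainder_nat) (use q(5) in auto)
  then obtain U where U: "\<And>j k. k < y \<Longrightarrow> [U j = u k j] (mod q k)"
    by (metis lessThan_iff)
  have Kk: "[K = k] (mod q k)" if "k < y" for k
    using q(1,2)[OF that] by (simp add: cong_altdef_nat)
  have env: "[app (Suc m) (case_nat K U) v i = app (Suc m) (case_nat k (u k)) v i] (mod q k)"
    if "k < y" for k i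
    by (rule app_cong_mod) (use Kk[OF that] U[OF that] in \<open>auto split: nat.splits\<close>)
  have "[L K U = R K U] (mod q k)" if "k < y" for k
  proof -
    have "[L K U = L k (u k)] (mod q k)" "[R K U = R k (u k)] (mod q k)"
      unfolding L_def R_def using assms env[OF that] by (auto intro: tmv_cong_mod)
    then show ?thesis using u(2)[OF that] by (metis cong_sym cong_trans)
  qed
  then have LR: "[L K U = R K U] (mod (K choose y))"
    unfolding q(4) using q(5) by (intro cong_cong_prod_coprime_nat) auto
  have "(K choose y) dvd (U j choose B)" if j: "j < m" for j
  proof (cases "U j < B")
    case False
    have "[(U j choose B) = 0] (mod q k)" if k: "k < y" for k
    proof -
      have "q k dvd U j - u k j"
        using U[OF k, of j] u(1)[OF k j] False by (simp add: cong_altdef_nat)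
      \<comment> \<open>As \<open>u k j < B\<close>, this difference is one of the factors.\<close>
      also have "U j - u k j dvd (\<Prod>i<B. U j - i)"
        using u(1)[OF k j] by (intro dvd_prodI) auto
      finally have "q k dvd fact B * (U j choose B)" unfolding fact_mult_binomial .
      moreover have "(fact B :: nat) dvd fact F" by (rule fact_dvd) (simp add: F_def)
      then have "coprime (q k) (fact B)" using q(3)[OF k] by (meson coprime_divisors dvd_refl)
      ultimately show ?thesis by (simp add: cong_0_iff coprime_dvd_mult_right_iff)
    qed
    then have "[(U j choose B) = 0] (mod (K choose y))"
      unfolding q(4) using q(5) by (intro cong_cong_prod_coprime_nat) auto
    then show ?thesis by (simp add: cong_0_iff)
  qed (simp add: binomial_eq_0)
  then show "\<exists>U K F f N. F = y + B + L y (\<lambda>_. B) + R y (\<lambda>_. B) + 3 \<and> f = fact F \<and> f * f dvd K + 1 \<and>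
      N = (K choose y) \<and> [L K U = R K U] (mod N) \<and> (\<forall>j<m. \<exists>c. c = (U j choose B) \<and> N dvd c)"
    using dvd LR F_def by blast
next
  assume "\<exists>U K F f N. F = y + B + L y (\<lambda>_. B) + R y (\<lambda>_. B) + 3 \<and> f = fact F \<and> f * f dvd K + 1 \<and>
      N = (K choose y) \<and> [L K U = R K U] (mod N) \<and> (\<forall>j<m. \<exists>c. c = (U j choose B) \<and> N dvd c)"
  then obtain U K F where F: "F = y + B + L y (\<lambda>_. B) + R y (\<lambda>_. B) + 3"
    and dvd: "fact F * fact F dvd K + 1" and LR: "[L K U = R K U] (mod (K choose y))"
    and UB: "\<And>j. j < m \<Longrightarrow> (K choose y) dvd (U j choose B)" by blast
  have "y \<le> F" "3 \<le> F" by (simp_all add: F)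
  from binomial_factors[OF dvd this] obtain q where q: "\<And>k. k < y \<Longrightarrow> K - k = (k + 1) * q k"
    "\<And>k. k < y \<Longrightarrow> k \<le> K" "\<And>k. k < y \<Longrightarrow> coprime (q k) (fact F)" "\<And>k. k < y \<Longrightarrow> q k > 1"
    "K choose y = (\<Prod>k<y. q k)"
    by metis
  show "\<forall>k<y. \<exists>u. (\<forall>j<m. u j < B) \<and> L k u = R k u"
  proof (intro allI impI)
    fix k assume k: "k < y"
    \<comment> \<open>A prime divisor must divide a single factor \<open>U j - x\<close> of the
      falling product; being coprime to \<open>fact F\<close>, it exceeds \<open>F\<close>.\<close>
    obtain s where s: "prime s" "s dvd q k" using q(4)[OF k] prime_factor_nat[of "q k"] by auto
    have "\<not> s dvd fact F" using q(3)[OF k] s by (meson coprime_common_divisor not_prime_unit)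
    then have sF: "s > F" using s(1) by (simp add: prime_dvd_fact_iff)
    have "q k dvd K choose y" unfolding q(5) using k by (intro dvd_prodI) auto
    then have sN: "s dvd K choose y" using s(2) dvd_trans by blast
    have "\<exists>x<B. [U j = x] (mod s)" if j: "j < m" for j
    proof (cases "U j < B")
      case False
      have "s dvd (\<Prod>i<B. U j - i)"
        unfolding fact_mult_binomial[symmetric] using UB[OF j] sN by (meson dvd_mult dvd_trans)
      then obtain x where "x < B" "s dvd U j - x"
        using s(1) by (auto simp: prime_dvd_prod_iff)
      then show ?thesis using False by (auto simp: cong_altdef_nat)
    qed auto
    then obtain u where u: "\<And>j. j < m \<Longrightarrow> u j < B" "\<And>j. j < m \<Longrightarrow> [U j = u j] (mod s)" by metis
    \<comment> \<open>The default 0 keeps \<open>u'\<close> below \<open>B\<close> at every index,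
      as monotonicity via \<open>app_le\<close> requires.\<close>
    define u' where "u' j = (if j < m then u j else 0)" for j
    have "[K = k] (mod q k)" using q(1,2)[OF k] by (simp add: cong_altdef_nat)
    then have "[K = k] (mod s)" using s(2) cong_dvd_modulus_nat by blast
    then have env: "[app (Suc m) (case_nat K U) v i = app (Suc m) (case_nat k u') v i] (mod s)" for i
      by (intro app_cong_mod) (use u in \<open>auto simp: u'_def split: nat.splits\<close>)
    have "[L K U = L k u'] (mod s)" "[R K U = R k u'] (mod s)"
      unfolding L_def R_def using assms env by (auto intro: tmv_cong_mod)
    moreover have "[L K U = R K U] (mod s)" using LR sN cong_dvd_modulus_nat by blast
    ultimately have "[L k u' = R k u'] (mod s)" by (metis cong_sym cong_trans)
    moreover have "L k u' \<le> L y (\<lambda>_. B)" "R k u' \<le> R y (\<lambda>_. B)"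
      unfolding L_def R_def using assms k u(1)
      by (auto intro!: tmv_mono app_le simp: u'_def less_imp_le split: nat.splits)
    then have "L k u' < s" "R k u' < s" using sF F by linarith+
    ultimately have "L k u' = R k u'" using cong_less_modulus_unique_nat by blast
    then show "\<exists>u. (\<forall>j<m. u j < B) \<and> L k u = R k u" using u(1) by (auto simp: u'_def intro!: exI[of _ u'])
  qed
qed

end

section \<open>Eliminating one bounded quantifier\<close>

context pow_base
begin

lemma tmf_app [dio_intros]:
  "(\<And>i. tmf (\<lambda>v. f v i)) \<Longrightarrow> (\<And>i. tmf (\<lambda>v. g v i)) \<Longrightarrow> tmf (\<lambda>v. app m (f v) (g v) i)"
  by (cases "i < m") (auto simp: app_def)

lemma tmf_if: "tmf f \<Longrightarrow> tmf g \<Longrightarrow> tmf (\<lambda>v. if c then f v else g v)"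
  by (cases c) auto

lemma tmf_case_nat [dio_intros]:
  "tmf f \<Longrightarrow> (\<And>j. tmf (\<lambda>v. g v j)) \<Longrightarrow> tmf (\<lambda>v. case_nat (f v) (g v) i)"
  by (cases i) auto

lemma dio_bounded_quantifier:
  assumes "pure l" "pure r"
  shows "dio (\<lambda>v. \<forall>k<v 0. \<exists>u. (\<forall>j<m. u j < v 1) \<and>
     tmv (app (Suc m) (case_nat k u) v) l = tmv (app (Suc m) (case_nat k u) v) r)"
proof (rule dio_iff[OF bounded_quantifier_characterization[OF assms]])
  \<comment> \<open>\<open>X\<close> depends on \<open>U\<close> through its first \<open>m\<close>
    values only, so \<open>U\<close> can be quantified as one block of \<open>m\<close>
    unknowns.\<close>
  define X where "X U v \<longleftrightarrow> (\<exists>K F f N. F = v 0 + v 1 + tmv (app (Suc m) (case_nat (v 0) (\<lambda>_. v 1)) v) l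
      + tmv (app (Suc m) (case_nat (v 0) (\<lambda>_. v 1)) v) r + 3 \<and> f = fact F \<and> f * f dvd K + 1 \<and>
      N = (K choose v 0) \<and>
      [tmv (app (Suc m) (case_nat K U) v) l = tmv (app (Suc m) (case_nat K U) v) r] (mod N) \<and>
      (\<forall>j<m. \<exists>c. c = (U j choose v 1) \<and> N dvd c))" for U v :: "nat \<Rightarrow> nat"
  have "dio (\<lambda>w. X (\<lambda>j. w j) (\<lambda>i. w (i + m)))"
    unfolding X_def by (intro dio_fact dio_binomial dio_intros dio_all_less)
  then have "dio (\<lambda>v. \<exists>U. X (\<lambda>j. app m U v j) (\<lambda>i. app m U v (i + m)))"
    by (rule dio_ex_block)
  moreover have "X (\<lambda>j. app m U v j) (\<lambda>i. app m U v (i + m)) \<longleftrightarrow> X U v" for U v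
  proof -
    have "(\<lambda>i. app m U v (i + m)) = v" by (simp add: app_def)
    moreover have "app (Suc m) (case_nat K (app m U v)) v = app (Suc m) (case_nat K U) v" for K
      by (auto simp: app_def fun_eq_iff split: nat.splits)
    moreover have "j < m \<Longrightarrow> app m U v j = U j" for j by (simp add: app_def)
    ultimately show ?thesis by (simp add: X_def)
  qed
  ultimately show "dio (\<lambda>v. \<exists>U K F f N. F = v 0 + v 1
      + tmv (app (Suc m) (case_nat (v 0) (\<lambda>_. v 1)) v) l
      + tmv (app (Suc m) (case_nat (v 0) (\<lambda>_. v 1)) v) r + 3 \<and> f = fact F \<and> f * f dvd K + 1 \<and>
      N = (K choose v 0) \<and>
      [tmv (app (Suc m) (case_nat K U) v) l = tmv (app (Suc m) (case_nat K U) v) r] (mod N) \<and>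
      (\<forall>j<m. \<exists>c. c = (U j choose v 1) \<and> N dvd c))"
    unfolding X_def by simp
qed

section \<open>Conditions given by a single polynomial equation\<close>

definition ptm :: "((nat \<Rightarrow> nat) \<Rightarrow> nat) \<Rightarrow> bool" where
  "ptm f \<longleftrightarrow> (\<exists>t. pure t \<and> (\<forall>v. f v = tmv v t))"

text \<open>No unknowns are allowed here: this is the form of the condition under the quantifier in
  \<open>dio_bounded_quantifier\<close>.\<close>

definition peq :: "((nat \<Rightarrow> nat) \<Rightarrow> bool) \<Rightarrow> bool" where
  "peq R \<longleftrightarrow> (\<exists>l r. pure l \<and> pure r \<and> (\<forall>v. R v \<longleftrightarrow> tmv v l = tmv v r))"

named_theorems peq_intros

lemma ptm_var [peq_intros]: "ptm (\<lambda>v. v i)"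
  unfolding ptm_def by (rule exI[of _ "Vr i"]) simp

lemma ptm_const [peq_intros]: "ptm (\<lambda>v. c)"
  unfolding ptm_def by (rule exI[of _ "Cn c"]) simp

lemma ptm_add [peq_intros]: "ptm f \<Longrightarrow> ptm g \<Longrightarrow> ptm (\<lambda>v. f v + g v)"
  unfolding ptm_def by (metis tmv.simps(3) pure.simps(3))

lemma ptm_mult [peq_intros]: "ptm f \<Longrightarrow> ptm g \<Longrightarrow> ptm (\<lambda>v. f v * g v)"
  unfolding ptm_def by (metis tmv.simps(4) pure.simps(4))

lemma ptm_tmv: "pure t \<Longrightarrow> (\<And>i. ptm (\<lambda>v. f v i)) \<Longrightarrow> ptm (\<lambda>v. tmv (f v) t)"
  by (induction t) (auto intro: peq_intros)

lemma peq_eq [peq_intros]: "ptm f \<Longrightarrow> ptm g \<Longrightarrow> peq (\<lambda>v. f v = g v)"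
  unfolding ptm_def peq_def by metis

lemma peq_iff: "(\<And>v. R v \<longleftrightarrow> R' v) \<Longrightarrow> peq R' \<Longrightarrow> peq R"
  by (simp add: peq_def)

text \<open>A sum of two squares vanishes iff both do; negative terms are moved to the other
  side.\<close>

lemma peq_conj [peq_intros]:
  assumes "peq R" "peq R'"
  shows "peq (\<lambda>v. R v \<and> R' v)"
proof -
  obtain l r l' r' where R: "pure l" "pure r" "\<And>v. R v \<longleftrightarrow> tmv v l = tmv v r"
    "pure l'" "pure r'" "\<And>v. R' v \<longleftrightarrow> tmv v l' = tmv v r'"
    using assms unfolding peq_def by blast
  have nat: "a = b \<and> c = d \<longleftrightarrow> a * a + b * b + (c * c + d * d) = 2 * (a * b) + 2 * (c * d)"
    for a b c d :: nat
  proof -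
    have "a = b \<and> c = d \<longleftrightarrow> (int a - int b)\<^sup>2 + (int c - int d)\<^sup>2 = 0"
      by (simp add: sum_power2_eq_zero_iff)
    also have "\<dots> \<longleftrightarrow> int (a * a + b * b + (c * c + d * d)) = int (2 * (a * b) + 2 * (c * d))"
      by (simp add: power2_eq_square algebra_simps)
    finally show ?thesis by (simp only: of_nat_eq_iff)
  qed
  show ?thesis unfolding R nat by (intro peq_intros ptm_tmv R)
qed

text \<open>The equation \<open>(a - b) * (c - d) = 0\<close>, rearranged without
  subtraction.\<close>

lemma peq_disj [peq_intros]:
  assumes "peq R" "peq R'"
  shows "peq (\<lambda>v. R v \<or> R' v)"
proof -
  obtain l r l' r' where R: "pure l" "pure r" "\<And>v. R v \<longleftrightarrow> tmv v l = tmv v r"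
    "pure l'" "pure r'" "\<And>v. R' v \<longleftrightarrow> tmv v l' = tmv v r'"
    using assms unfolding peq_def by blast
  have nat: "a = b \<or> c = d \<longleftrightarrow> a * c + b * d = a * d + b * c" for a b c d :: nat
  proof -
    have "a = b \<or> c = d \<longleftrightarrow> (int a - int b) * (int c - int d) = 0" by simp
    also have "\<dots> \<longleftrightarrow> int (a * c + b * d) = int (a * d + b * c)"
      unfolding of_nat_add of_nat_mult by (auto simp: algebra_simps)
    finally show ?thesis by (simp only: of_nat_eq_iff)
  qed
  show ?thesis unfolding R nat by (intro peq_intros ptm_tmv R)
qed

lemma peq_bex_list:
  "(\<And>c. c \<in> set cs \<Longrightarrow> peq (R c)) \<Longrightarrow> peq (\<lambda>v. \<exists>c \<in> set cs. R c v)"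
proof (induction cs)
  case Nil
  have "peq (\<lambda>v. (0::nat) = 1)" by (intro peq_intros)
  then show ?case by simp
next
  case (Cons c cs)
  then have "peq (\<lambda>v. R c v \<or> (\<exists>c \<in> set cs. R c v))" by (intro peq_disj) auto
  then show ?case by simp
qed

section \<open>Derivations as finite sequences of numbers\<close>

inductive deriv :: "(tm \<times> tm \<times> tm) list \<Rightarrow> nat \<Rightarrow> bool" for C where
  deriv_0: "deriv C 0"
| deriv_step: "(c0, c1, c2) \<in> set C \<Longrightarrow> deriv C (tmv z c1) \<Longrightarrow> deriv C (tmv z c2) \<Longrightarrow> deriv C (tmv z c0)"

text \<open>A clause lists its conclusion before its two premises. Checking one entry of a
  derivation sequence involves only two earlier entries and one instance of a clause.\<close>

inductive justified :: "(tm \<times> tm \<times> tm) list \<Rightarrow> (nat \<Rightarrow> nat) \<Rightarrow> nat \<Rightarrow> bool" for C s k where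
  justified_0: "s k = 0 \<Longrightarrow> justified C s k"
| justified_step: "(c0, c1, c2) \<in> set C \<Longrightarrow> i < k \<Longrightarrow> j < k \<Longrightarrow> s k = tmv z c0 \<Longrightarrow> s i = tmv z c1 \<Longrightarrow>
     s j = tmv z c2 \<Longrightarrow> justified C s k"

lemma justified_cong:
  assumes "justified C s k" and eq: "\<And>i. i \<le> k \<Longrightarrow> s' i = s i"
  shows "justified C s' k"
  using assms(1)
proof cases
  case justified_0
  then show ?thesis by (intro justified.justified_0) (simp add: eq)
next
  case (justified_step c0 c1 c2 i j z)
  then show ?thesis by (intro justified.justified_step[of c0 c1 c2 C i k j s' z]) (simp_all add: eq)
qed

lemma deriv_if_justified: "(\<And>i. i \<le> k \<Longrightarrow> justified C s i) \<Longrightarrow> deriv C (s k)"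
proof (induction k rule: less_induct)
  case (less k)
  have "justified C s k" using less.prems by simp
  then show ?case
  proof cases
    case justified_0
    then show ?thesis by (simp add: deriv_0)
  next
    case (justified_step c0 c1 c2 i j z)
    have "deriv C (s i)" by (rule less.IH) (use justified_step less.prems in auto)
    moreover have "deriv C (s j)" by (rule less.IH) (use justified_step less.prems in auto)
    ultimately show ?thesis using deriv_step[OF justified_step(1), of z] justified_step by metis
  qed
qed

lemma justified_shift:
  assumes "justified C s k"
  shows "justified C (\<lambda>i. if i < n then s' i else s (i - n)) (k + n)"
  using assms
proof cases
  case justified_0
  then show ?thesis by (intro justified.justified_0) simp
next
  case (justified_step c0 c1 c2 i j z)
  then show ?thesis by (intro justified.justified_step[of c0 c1 c2 C "i + n" _ "j + n" _ z]) simp_all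
qed

lemma justified_if_deriv: "deriv C x \<Longrightarrow> \<exists>s k. (\<forall>i\<le>k. justified C s i) \<and> s k = x"
proof (induction rule: deriv.induct)
  case deriv_0
  show ?case by (rule exI[of _ "\<lambda>_. 0"]) (simp add: justified_0)
next
  case (deriv_step c0 c1 c2 z)
  obtain s k where s: "\<And>i. i \<le> k \<Longrightarrow> justified C s i" "s k = tmv z c1" using deriv_step.IH(1) by auto
  obtain s' k' where s': "\<And>i. i \<le> k' \<Longrightarrow> justified C s' i" "s' k' = tmv z c2" using deriv_step.IH(2) by auto
  \<comment> \<open>\<open>t\<close> concatenates the derivations of the two premises;
    \<open>n\<close> is the first position after both and receives the conclusion.\<close>
  define t where "t i = (if i < Suc k then s i else s' (i - Suc k))" for i
  define n where "n = Suc (k' + Suc k)"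
  define u where "u = t(n := tmv z c0)"
  have t: "justified C t i" if "i < n" for i
  proof (cases "i < Suc k")
    case True
    then show ?thesis by (intro justified_cong[OF s(1)[of i]]) (auto simp: t_def)
  next
    case False
    then have "i - Suc k \<le> k'" using that by (simp add: n_def)
    from justified_shift[OF s'(1)[OF this], of "Suc k" s] show ?thesis
      using False unfolding t_def[abs_def] by simp
  qed
  have "justified C u i" if "i < n" for i
    using that by (intro justified_cong[OF t[OF that]]) (auto simp: u_def)
  moreover have "justified C u n"
  proof (rule justified_step[OF deriv_step.hyps(1)])
    show "k < n" "k' + Suc k < n" by (auto simp: n_def)
    show "u n = tmv z c0" by (simp add: u_def)
    show "u k = tmv z c1" using s(2) by (simp add: u_def t_def n_def)
    show "u (k' + Suc k) = tmv z c2" using s'(2) by (simp add: u_def t_def n_def)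
  qed
  ultimately have "\<forall>i\<le>n. justified C u i" by (simp add: le_less)
  moreover have "u n = tmv z c0" by (simp add: u_def)
  ultimately show ?case by blast
qed

section \<open>Sequences coded by the beta function\<close>

definition bt :: "nat \<Rightarrow> nat \<Rightarrow> nat \<Rightarrow> nat" where
  "bt c d k = c mod (1 + (k + 1) * d)"

text \<open>Division with remainder as two equations: \<open>Q\<close> is the quotient and
  \<open>w\<close> the slack in \<open>x \<le> (k + 1) * d\<close>.\<close>

lemma bt_characterization:
  "x = bt c d k \<longleftrightarrow> (\<exists>Q w. c = Q * (1 + (k + 1) * d) + x \<and> x + w = (k + 1) * d)"
proof
  assume x: "x = bt c d k"
  have "x < 1 + (k + 1) * d" unfolding x bt_def by (rule mod_less_divisor) simp
  then have "x + ((k + 1) * d - x) = (k + 1) * d" by linarith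
  moreover have "c = c div (1 + (k + 1) * d) * (1 + (k + 1) * d) + x"
    unfolding x bt_def by (rule div_mult_mod_eq[symmetric])
  ultimately show "\<exists>Q w. c = Q * (1 + (k + 1) * d) + x \<and> x + w = (k + 1) * d" by blast
next
  assume "\<exists>Q w. c = Q * (1 + (k + 1) * d) + x \<and> x + w = (k + 1) * d"
  then obtain Q w where c: "c = Q * (1 + (k + 1) * d) + x" and "x + w = (k + 1) * d" by blast
  then have "x < 1 + (k + 1) * d" by linarith
  then show "x = bt c d k" unfolding bt_def c by (simp only: mod_mult_self3 mod_less)
qed

text \<open>The moduli are pairwise coprime: a common divisor of two of them is coprime to
  \<open>d\<close> and divides \<open>(l - k) * d\<close>, while \<open>l - k\<close> divides
  \<open>d\<close>.\<close>

lemma bt_exists: "\<exists>c d. \<forall>k\<le>n. bt c d k = s k"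
proof -
  \<comment> \<open>\<open>F > n\<close> makes all differences of positions divide
    \<open>fact F\<close>; \<open>F \<ge> s k\<close> makes every entry smaller than its
    modulus.\<close>
  define F where "F = Suc n + (\<Sum>k\<le>n. s k)"
  define d where "d = (fact F :: nat)"
  define m where "m k = 1 + (k + 1) * d" for k
  have lt: "coprime (m k) (m l)" if "k < l" "l \<le> n" for k l
  proof (rule coprimeI)
    fix g assume g: "g dvd m k" "g dvd m l"
    have "coprime (m k) d"
      unfolding m_def by (rule coprimeI) (metis dvd_add_left_iff dvd_mult)
    then have gd: "coprime g d" using g(1) by (meson coprime_divisors dvd_refl)
    have "g dvd m l - m k" using g by (simp add: dvd_diff_nat)
    also have "m l - m k = (l - k) * d" using that by (simp add: m_def algebra_simps diff_mult_distrib)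
    finally have "g dvd (l - k)" using gd by (simp add: coprime_dvd_mult_left_iff)
    also have "l - k dvd d" unfolding d_def using that by (intro dvd_fact) (auto simp: F_def)
    finally show "g dvd 1" using gd by (metis coprime_common_divisor dvd_refl)
  qed
  have "coprime (m k) (m l)" if "k \<le> n" "l \<le> n" "k \<noteq> l" for k l
    using lt[of k l] lt[of l k] that by (cases "k < l") (auto simp: coprime_commute)
  then have "\<exists>c. \<forall>k\<in>{..n}. [c = s k] (mod m k)"
    by (intro chinese_remainder_nat) auto
  then obtain c where c: "\<And>k. k \<le> n \<Longrightarrow> [c = s k] (mod m k)" by auto
  have "bt c d k = s k" if "k \<le> n" for k
  proof -
    have "s k \<le> (\<Sum>k\<le>n. s k)" using that by (intro member_le_sum) auto
    also have "\<dots> \<le> F" by (simp add: F_def)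
    also have "F \<le> d" unfolding d_def by (rule fact_ge_self)
    also have "d < m k" by (simp add: m_def)
    finally show ?thesis using c[OF that] by (simp add: bt_def m_def cong_def)
  qed
  then show ?thesis by blast
qed

lemma deriv_iff_bt: "deriv C x \<longleftrightarrow> (\<exists>y c d. (\<forall>k<Suc y. justified C (bt c d) k) \<and> x = bt c d y)"
proof
  assume "deriv C x"
  from justified_if_deriv[OF this] obtain s y where s: "\<And>i. i \<le> y \<Longrightarrow> justified C s i" "s y = x" by auto
  obtain c d where cd: "\<And>k. k \<le> y \<Longrightarrow> bt c d k = s k" using bt_exists[of y s] by auto
  have "justified C (bt c d) k" if "k < Suc y" for k
    using that by (intro justified_cong[OF s(1)[of k]] cd) auto
  then show "\<exists>y c d. (\<forall>k<Suc y. justified C (bt c d) k) \<and> x = bt c d y"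
    using cd[of y] s(2) by auto
next
  assume "\<exists>y c d. (\<forall>k<Suc y. justified C (bt c d) k) \<and> x = bt c d y"
  then show "deriv C x" using deriv_if_justified less_Suc_eq_le by blast
qed

fun vb :: "nat \<Rightarrow> tm \<Rightarrow> bool" where
  "vb n (Vr i) \<longleftrightarrow> i < n"
| "vb n (Cn c) \<longleftrightarrow> True"
| "vb n (Pl s t) \<longleftrightarrow> vb n s \<and> vb n t"
| "vb n (Tm s t) \<longleftrightarrow> vb n s \<and> vb n t"
| "vb n (Pw s) \<longleftrightarrow> vb n s"

lemma tmv_agree: "vb n t \<Longrightarrow> (\<And>i. i < n \<Longrightarrow> u i = v i) \<Longrightarrow> tmv u t = tmv v t"
  by (induction t) auto

text \<open>In the environment \<open>e\<close>, \<open>e 0\<close> is the position \<open>k\<close>, \<open>e 1, \<dots>, e 4\<close> instantiate the clause,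
  \<open>e 5\<close> and \<open>e 6\<close> are the positions of its premises, \<open>e 7, e 8, e 9\<close> the sequence elements at these
  three positions, \<open>e 10, \<dots>, e 17\<close> quotients and slacks, and \<open>e 20, e 21\<close> code the sequence.\<close>
definition local_eq :: "(tm \<times> tm \<times> tm) list \<Rightarrow> (nat \<Rightarrow> nat) \<Rightarrow> bool" where
  "local_eq C e \<longleftrightarrow> e 20 = e 10 * (1 + (e 0 + 1) * e 21) + e 7 \<and> e 7 + e 13 = (e 0 + 1) * e 21 \<and>
     (e 7 = 0 \<or>
      (e 20 = e 11 * (1 + (e 5 + 1) * e 21) + e 8 \<and> e 8 + e 14 = (e 5 + 1) * e 21 \<and>
       e 20 = e 12 * (1 + (e 6 + 1) * e 21) + e 9 \<and> e 9 + e 15 = (e 6 + 1) * e 21 \<and>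
       e 5 + e 16 + 1 = e 0 \<and> e 6 + e 17 + 1 = e 0 \<and>
       (\<exists>c \<in> set C. e 7 = tmv (\<lambda>i. e (i + 1)) (fst c) \<and> e 8 = tmv (\<lambda>i. e (i + 1)) (fst (snd c)) \<and>
          e 9 = tmv (\<lambda>i. e (i + 1)) (snd (snd c)))))"

lemma peq_local_eq:
  assumes "\<And>c. c \<in> set C \<Longrightarrow> pure (fst c) \<and> pure (fst (snd c)) \<and> pure (snd (snd c))"
  shows "peq (local_eq C)"
  by (rule peq_iff[OF local_eq_def])
    (intro peq_conj peq_disj peq_eq peq_intros peq_bex_list ptm_tmv; use assms in blast)

text \<open>\<open>app 18\<close> shifts \<open>v\<close> by 18, so \<open>v 2\<close> and
  \<open>v 3\<close> are the positions 20 and 21 of \<open>local_eq\<close>.\<close>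

lemma justified_iff_local_eq:
  assumes "\<And>c. c \<in> set C \<Longrightarrow> vb 4 (fst c) \<and> vb 4 (fst (snd c)) \<and> vb 4 (snd (snd c))"
    and v: "v 2 = c" "v 3 = d"
  shows "justified C (bt c d) k \<longleftrightarrow> (\<exists>u. local_eq C (app 18 (case_nat k u) v))"
proof
  assume "justified C (bt c d) k"
  then show "\<exists>u. local_eq C (app 18 (case_nat k u) v)"
  proof cases
    case justified_0
    obtain Q w where Q: "c = Q * (1 + (k + 1) * d) + 0" "0 + w = (k + 1) * d"
      using bt_characterization[of 0 c d k] justified_0 by auto
    \<comment> \<open>\<open>case_nat\<close> puts \<open>k\<close> at position 0, so positions 10
      and 13 are the values at 9 and 12.\<close>
    let ?e = "app 18 (case_nat k ((\<lambda>_. 0)(9 := Q, 12 := w))) v"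
    have "?e 0 = k" "?e 7 = 0" "?e 10 = Q" "?e 13 = w" "?e 20 = c" "?e 21 = d"
      using v by (simp_all add: app_def numeral_eq_Suc)
    then have "local_eq C ?e" unfolding local_eq_def using Q by simp
    then show ?thesis by blast
  next
    case (justified_step c0 c1 c2 i j z)
    obtain Q w where Q: "c = Q * (1 + (k + 1) * d) + bt c d k" "bt c d k + w = (k + 1) * d"
      using bt_characterization[of "bt c d k" c d k] by auto
    obtain Q1 w1 where Q1: "c = Q1 * (1 + (i + 1) * d) + bt c d i" "bt c d i + w1 = (i + 1) * d"
      using bt_characterization[of "bt c d i" c d i] by auto
    obtain Q2 w2 where Q2: "c = Q2 * (1 + (j + 1) * d) + bt c d j" "bt c d j + w2 = (j + 1) * d"
      using bt_characterization[of "bt c d j" c d j] by auto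
    \<comment> \<open>Listed by the positions of \<open>local_eq\<close> less one; the last two
      entries are the slacks in \<open>i < k\<close> and \<open>j < k\<close>.\<close>
    define u where "u = (!) [z 0, z 1, z 2, z 3, i, j, bt c d k, bt c d i, bt c d j,
       Q, Q1, Q2, w, w1, w2, k - i - 1, k - j - 1]"
    let ?e = "app 18 (case_nat k u) v"
    have e: "?e 0 = k" "?e 5 = i" "?e 6 = j" "?e 7 = bt c d k" "?e 8 = bt c d i" "?e 9 = bt c d j"
      "?e 10 = Q" "?e 11 = Q1" "?e 12 = Q2" "?e 13 = w" "?e 14 = w1" "?e 15 = w2"
      "?e 16 = k - i - 1" "?e 17 = k - j - 1" "?e 20 = c" "?e 21 = d"
      using v by (simp_all add: app_def numeral_eq_Suc u_def)
    have z: "?e (x + 1) = z x" if "x < 4" for x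
      using that by (auto simp: app_def u_def less_Suc_eq numeral_eq_Suc)
    have vb: "vb 4 c0" "vb 4 c1" "vb 4 c2" using assms(1)[OF justified_step(1)] by auto
    have agree: "tmv (\<lambda>x. ?e (x + 1)) t = tmv z t" if "vb 4 t" for t
      using that z by (rule tmv_agree)
    have "\<exists>c \<in> set C. ?e 7 = tmv (\<lambda>i. ?e (i + 1)) (fst c) \<and> ?e 8 = tmv (\<lambda>i. ?e (i + 1)) (fst (snd c)) \<and>
          ?e 9 = tmv (\<lambda>i. ?e (i + 1)) (snd (snd c))"
      using justified_step agree[OF vb(1)] agree[OF vb(2)] agree[OF vb(3)] unfolding e
      by (intro bexI[OF _ justified_step(1)]) simp
    then have "local_eq C ?e" unfolding local_eq_def e using Q Q1 Q2 justified_step(2,3) by simp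
    then show ?thesis by blast
  qed
next
  assume "\<exists>u. local_eq C (app 18 (case_nat k u) v)"
  then obtain u where u: "local_eq C (app 18 (case_nat k u) v)" by blast
  define e where "e = app 18 (case_nat k u) v"
  have e: "e 0 = k" "e 20 = c" "e 21 = d" using v by (simp_all add: e_def app_def numeral_eq_Suc)
  note u = u[folded e_def, unfolded local_eq_def e]
  have 7: "e 7 = bt c d k" using u bt_characterization by blast
  show "justified C (bt c d) k"
  proof (cases "e 7 = 0")
    case True
    then show ?thesis using 7 by (simp add: justified_0)
  next
    case False
    note h = u[THEN conjunct2, THEN conjunct2, unfolded disj_imp, THEN mp, OF False]
    note h1 = conjunct1[OF h] and h2 = conjunct1[OF conjunct2[OF h]] and r = conjunct2[OF conjunct2[OF h]]
    note h3 = conjunct1[OF r] and h4 = conjunct1[OF conjunct2[OF r]] and r' = conjunct2[OF conjunct2[OF r]]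
    note h5 = conjunct1[OF r'] and h6 = conjunct1[OF conjunct2[OF r']]
      and ex = conjunct2[OF conjunct2[OF r']]
    have 8: "e 8 = bt c d (e 5)" unfolding bt_characterization by (intro exI conjI, rule h1, rule h2)
    have 9: "e 9 = bt c d (e 6)" unfolding bt_characterization by (intro exI conjI, rule h3, rule h4)
    have lt: "e 5 < k" "e 6 < k" using h5 h6 by linarith+
    obtain x where "x \<in> set C" "e 7 = tmv (\<lambda>i. e (i + 1)) (fst x)"
      "e 8 = tmv (\<lambda>i. e (i + 1)) (fst (snd x))" "e 9 = tmv (\<lambda>i. e (i + 1)) (snd (snd x))"
      using ex by blast
    then show ?thesis using lt unfolding 7 8 9
      by (intro justified_step[of "fst x" "fst (snd x)" "snd (snd x)"]) simp_all
  qed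
qed

text \<open>Finitely many witnesses have a common bound; this supplies the bound that
  \<open>dio_bounded_quantifier\<close> demands.\<close>

lemma common_bound:
  fixes y m :: nat and R :: "nat \<Rightarrow> (nat \<Rightarrow> nat) \<Rightarrow> bool"
  assumes "\<And>u u' k. (\<And>j. j < m \<Longrightarrow> u j = u' j) \<Longrightarrow> R k u \<longleftrightarrow> R k u'"
  shows "(\<forall>k<y. \<exists>u. R k u) \<longleftrightarrow> (\<exists>B. \<forall>k<y. \<exists>u. (\<forall>j<m. u j < B) \<and> R k u)"
proof
  assume "\<forall>k<y. \<exists>u. R k u"
  then obtain u :: "nat \<Rightarrow> nat \<Rightarrow> nat" where u: "\<And>k. k < y \<Longrightarrow> R k (u k)" by metis
  define B where "B = Suc (\<Sum>k<y. \<Sum>j<m. u k j)"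
  have "u k j < B" if "k < y" "j < m" for k j
  proof -
    have "u k j \<le> (\<Sum>j<m. u k j)" using that by (intro member_le_sum) auto
    also have "\<dots> \<le> (\<Sum>k<y. \<Sum>j<m. u k j)"
      using that by (intro member_le_sum[where f = "\<lambda>k. \<Sum>j<m. u k j"]) auto
    finally show ?thesis by (simp add: B_def)
  qed
  then show "\<exists>B. \<forall>k<y. \<exists>u. (\<forall>j<m. u j < B) \<and> R k u" using u by blast
qed blast

lemma dio_deriv:
  assumes C: "\<And>c. c \<in> set C \<Longrightarrow> pure (fst c) \<and> pure (fst (snd c)) \<and> pure (snd (snd c))"
    "\<And>c. c \<in> set C \<Longrightarrow> vb 4 (fst c) \<and> vb 4 (fst (snd c)) \<and> vb 4 (snd (snd c))"
    and f: "tmf f"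
  shows "dio (\<lambda>v. deriv C (f v))"
proof -
  \<comment> \<open>The layout agrees with \<open>dio_bounded_quantifier\<close> (length, bound) and
    \<open>justified_iff_local_eq\<close> (code \<open>c\<close>, \<open>d\<close>).\<close>
  define env :: "nat \<Rightarrow> nat \<Rightarrow> nat \<Rightarrow> nat \<Rightarrow> nat \<Rightarrow> nat" where
    "env y B c d = (\<lambda>i. if i = 0 then y else if i = 1 then B else if i = 2 then c else d)" for y B c d
  define X where "X v \<longleftrightarrow> (\<forall>k<v 0. \<exists>u. (\<forall>j<17. u j < v 1) \<and> local_eq C (app 18 (case_nat k u) v))"
    for v :: "nat \<Rightarrow> nat"
  obtain l r where lr: "pure l" "pure r" "\<And>v. local_eq C v \<longleftrightarrow> tmv v l = tmv v r"
    using peq_local_eq[OF C(1)] unfolding peq_def by blast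
  have "dio X"
    using dio_bounded_quantifier[OF lr(1,2), of 17] by (simp add: X_def[abs_def] lr(3))
  have "deriv C x \<longleftrightarrow> (\<exists>y B c d. X (env (Suc y) B c d) \<and> x = bt c d y)" for x
  proof -
    have "(\<forall>k<Suc y. justified C (bt c d) k) \<longleftrightarrow> (\<exists>B. X (env (Suc y) B c d))" for y c d
    proof -
      have agree: "app 18 (case_nat k u) (env (Suc y) B c d) i = app 18 (case_nat k u') (env (Suc y) B' c d) i"
        if "\<And>j. j < 17 \<Longrightarrow> u j = u' j" "i \<noteq> 19" for k u u' B B' i
        using that by (auto simp: app_def env_def split: nat.splits)
      \<comment> \<open>Position 19 = 18 + 1 holds the bound \<open>B\<close>; the truth of
        \<open>local_eq\<close> is independent of it, so \<open>B\<close> may be varied.\<close>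
      have le: "local_eq C e \<longleftrightarrow> local_eq C e'" if "\<And>i. i \<noteq> 19 \<Longrightarrow> e i = e' i" for e e'
      proof -
        have "tmv (\<lambda>i. e (i + 1)) t = tmv (\<lambda>i. e' (i + 1)) t" if "vb 4 t" for t
          using that \<open>\<And>i. i \<noteq> 19 \<Longrightarrow> e i = e' i\<close> by (intro tmv_agree) auto
        then show ?thesis using C(2) that unfolding local_eq_def by (auto cong: bex_cong)
      qed
      have "(\<forall>k<Suc y. justified C (bt c d) k) \<longleftrightarrow>
          (\<forall>k<Suc y. \<exists>u. local_eq C (app 18 (case_nat k u) (env (Suc y) 0 c d)))"
        using justified_iff_local_eq[OF C(2), where v = "env (Suc y) 0 c d" and c = c and d = d] by (simp add: env_def)
      also have "\<dots> \<longleftrightarrow> (\<exists>B. \<forall>k<Suc y. \<exists>u. (\<forall>j<17. u j < B) \<and>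
          local_eq C (app 18 (case_nat k u) (env (Suc y) 0 c d)))"
        by (rule common_bound) (rule le, rule agree)
      also have "\<dots> \<longleftrightarrow> (\<exists>B. X (env (Suc y) B c d))"
      proof -
        have "local_eq C (app 18 (case_nat k u) (env (Suc y) 0 c d)) \<longleftrightarrow>
            local_eq C (app 18 (case_nat k u) (env (Suc y) B c d))" for k u B
          by (rule le, rule agree) auto
        moreover have "env (Suc y) B c d 0 = Suc y" "env (Suc y) B c d 1 = B" for B
          by (simp_all add: env_def)
        ultimately have "X (env (Suc y) B c d) \<longleftrightarrow> (\<forall>k<Suc y. \<exists>u. (\<forall>j<17. u j < B) \<and>
            local_eq C (app 18 (case_nat k u) (env (Suc y) 0 c d)))" for B
          unfolding X_def by metis
        then show ?thesis by simp
      qed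
      finally show ?thesis .
    qed
    then show ?thesis unfolding deriv_iff_bt by blast
  qed
  moreover have "dio (\<lambda>v. \<exists>y B c d. X (env (Suc y) B c d) \<and> v 0 = bt c d y)"
    unfolding bt_characterization
  proof (intro dio_ex dio_conj dio_less dio_eq dio_intros)
    show "dio (\<lambda>v. X (env (Suc (v (Suc (Suc (Suc 0))))) (v (Suc (Suc 0))) (v (Suc 0)) (v 0)))"
      unfolding env_def by (rule dio_comp[OF \<open>dio X\<close>]) (intro tmf_if dio_intros)
  qed
  ultimately have "dio (\<lambda>v. deriv C (v 0))" by simp
  from dio_comp[OF this, of "\<lambda>_. f"] f show ?thesis by simp
qed

end

section \<open>Derivations for recursive functions\<close>

instance recf :: countable
  by countable_datatype

text \<open>\<open>EvL\<close> evaluates the argument list of a composition; \<open>Below\<close>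
  collects the nonzero values required by minimisation.\<close>

datatype node = Ev recf | EvL "recf list" | Below recf

instance node :: countable
  by countable_datatype

text \<open>A polynomial pairing without division. It is injective because \<open>x\<close> is
  smaller than the gap \<open>2 * (x + y) + 1\<close> to the next square.\<close>

definition pr :: "nat \<Rightarrow> nat \<Rightarrow> nat" where
  "pr x y = (x + y) * (x + y) + x"

lemma pr_inject [simp]: "pr x y = pr x' y' \<longleftrightarrow> x = x' \<and> y = y'"
proof
  assume eq: "pr x y = pr x' y'"
  have le: "a + c \<le> a' + c'" if "pr a c = pr a' c'" for a c a' c'
  proof (rule ccontr)
    assume "\<not> a + c \<le> a' + c'"
    then have "Suc (a' + c') * Suc (a' + c') \<le> (a + c) * (a + c)" by (intro mult_le_mono) auto
    then show False using that by (simp add: pr_def)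
  qed
  have "x + y = x' + y'" using le[OF eq] le[OF eq[symmetric]] by simp
  then show "x = x' \<and> y = y'" using eq by (simp add: pr_def)
qed simp

text \<open>The successor separates nonempty lists from the code 0 of the empty list.\<close>

definition cons :: "nat \<Rightarrow> nat \<Rightarrow> nat" where
  "cons x l = Suc (pr x l)"

fun code :: "nat list \<Rightarrow> nat" where
  "code [] = 0"
| "code (x # xs) = cons x (code xs)"

lemma cons_eq_code: "cons x l = code xs \<longleftrightarrow> (\<exists>xs'. xs = x # xs' \<and> l = code xs')"
  by (cases xs) (auto simp: cons_def)

lemma cons_eq_cons [simp]: "cons x l = cons x' l' \<longleftrightarrow> x = x' \<and> l = l'"
  by (simp add: cons_def)

lemma code_inject [simp]: "code xs = code ys \<longleftrightarrow> xs = ys"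
proof (induction xs arbitrary: ys)
  case Nil
  show ?case by (cases ys) (auto simp: cons_def)
next
  case (Cons x xs)
  then show ?case by (cases ys) (auto simp: cons_def)
qed

text \<open>The successor makes every judgement different from 0, the axiom of
  \<open>deriv\<close>.\<close>

definition judgement :: "node \<Rightarrow> nat \<Rightarrow> nat \<Rightarrow> nat" where
  "judgement nd l v = pr (Suc (to_nat nd)) (pr l v)"

lemma judgement_inject [simp]:
  "judgement nd l v = judgement nd' l' v' \<longleftrightarrow> nd = nd' \<and> l = l' \<and> v = v'"
  by (simp add: judgement_def)

lemma judgement_neq_0 [simp]: "0 \<noteq> judgement nd l v"
  by (simp add: judgement_def pr_def)

section \<open>Clauses that describe recursive functions\<close>

abbreviation "tpr s t \<equiv> Pl (Tm (Pl s t) (Pl s t)) s"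

definition tcons :: "tm \<Rightarrow> tm \<Rightarrow> tm" where
  "tcons s t = Pl (tpr s t) (Cn 1)"

definition tjudgement :: "node \<Rightarrow> tm \<Rightarrow> tm \<Rightarrow> tm" where
  "tjudgement nd s t = tpr (Cn (Suc (to_nat nd))) (tpr s t)"

text \<open>The clauses \<open>(c, c', c'')\<close> deriving judgements about a node; a missing premise is the
  derivable constant 0.\<close>
fun node_clauses :: "node \<Rightarrow> (tm \<times> tm \<times> tm) list" where
  "node_clauses (Ev Zero) = [(tjudgement (Ev Zero) (Vr 1) (Cn 0), Cn 0, Cn 0)]"
| "node_clauses (Ev Succ) = [(tjudgement (Ev Succ) (tcons (Vr 0) (Vr 1)) (Pl (Vr 0) (Cn 1)), Cn 0, Cn 0)]"
| "node_clauses (Ev (Proj 0)) = [(tjudgement (Ev (Proj 0)) (tcons (Vr 0) (Vr 1)) (Vr 0), Cn 0, Cn 0)]"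
| "node_clauses (Ev (Proj (Suc i))) =
    [(tjudgement (Ev (Proj (Suc i))) (tcons (Vr 0) (Vr 1)) (Vr 3),
      tjudgement (Ev (Proj i)) (Vr 1) (Vr 3), Cn 0)]"
| "node_clauses (Ev (Comp f gs)) =
    [(tjudgement (Ev (Comp f gs)) (Vr 1) (Vr 3),
      tjudgement (EvL gs) (Vr 1) (Vr 2), tjudgement (Ev f) (Vr 2) (Vr 3))]"
| "node_clauses (Ev (Prec f g)) =
    [(tjudgement (Ev (Prec f g)) (tcons (Cn 0) (Vr 1)) (Vr 3), tjudgement (Ev f) (Vr 1) (Vr 3), Cn 0),
     (tjudgement (Ev (Prec f g)) (tcons (Pl (Vr 0) (Cn 1)) (Vr 1)) (Vr 3),
      tjudgement (Ev (Prec f g)) (tcons (Vr 0) (Vr 1)) (Vr 2),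
      tjudgement (Ev g) (tcons (Vr 0) (tcons (Vr 2) (Vr 1))) (Vr 3))]"
| "node_clauses (Ev (Mini f)) =
    [(tjudgement (Ev (Mini f)) (Vr 1) (Vr 0),
      tjudgement (Ev f) (tcons (Vr 0) (Vr 1)) (Cn 0), tjudgement (Below f) (tcons (Vr 0) (Vr 1)) (Cn 0))]"
| "node_clauses (EvL []) = [(tjudgement (EvL []) (Vr 1) (Cn 0), Cn 0, Cn 0)]"
| "node_clauses (EvL (g # gs)) =
    [(tjudgement (EvL (g # gs)) (Vr 1) (tcons (Vr 0) (Vr 2)),
      tjudgement (Ev g) (Vr 1) (Vr 0), tjudgement (EvL gs) (Vr 1) (Vr 2))]"
| "node_clauses (Below f) =
    [(tjudgement (Below f) (tcons (Cn 0) (Vr 1)) (Cn 0), Cn 0, Cn 0),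
     (tjudgement (Below f) (tcons (Pl (Vr 0) (Cn 1)) (Vr 1)) (Cn 0),
      tjudgement (Below f) (tcons (Vr 0) (Vr 1)) (Cn 0),
      tjudgement (Ev f) (tcons (Vr 0) (Vr 1)) (Pl (Vr 2) (Cn 1)))]"

fun tails :: "'a list \<Rightarrow> 'a list list" where
  "tails [] = [[]]"
| "tails (x # xs) = (x # xs) # tails xs"

text \<open>All nodes that a derivation for the function can visit: the clause of a projection
  strips one list entry and lowers the index, and that of \<open>EvL\<close> passes to the
  tail.\<close>

fun nodes :: "recf \<Rightarrow> node list" where
  "nodes Zero = [Ev Zero]"
| "nodes Succ = [Ev Succ]"
| "nodes (Proj i) = map (\<lambda>j. Ev (Proj j)) [0..<Suc i]"
| "nodes (Comp f gs) = Ev (Comp f gs) # map EvL (tails gs) @ nodes f @ concat (map nodes gs)"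
| "nodes (Prec f g) = Ev (Prec f g) # nodes f @ nodes g"
| "nodes (Mini f) = Ev (Mini f) # Below f # nodes f"

definition clauses :: "recf \<Rightarrow> (tm \<times> tm \<times> tm) list" where
  "clauses f = concat (map node_clauses (nodes f))"

text \<open>Conditional on \<open>l\<close> being the code of a list, because \<open>pr\<close> is
  not surjective and so not every number is one.\<close>

fun sem :: "node \<Rightarrow> nat \<Rightarrow> nat \<Rightarrow> bool" where
  "sem (Ev f) l v \<longleftrightarrow> (\<forall>xs. l = code xs \<longrightarrow> eval f xs v)"
| "sem (EvL gs) l v \<longleftrightarrow> (\<forall>xs. l = code xs \<longrightarrow> (\<exists>ys. v = code ys \<and> list_all2 (\<lambda>g y. eval g xs y) gs ys))"
| "sem (Below f) l v \<longleftrightarrow> (\<forall>n xs. l = code (n # xs) \<longrightarrow> (\<forall>m<n. \<exists>k. k \<noteq> 0 \<and> eval f (m # xs) k))"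

lemma eval_Proj_0: "eval (Proj 0) (x # xs) x"
  using eval_proj[of 0 "x # xs"] by simp

lemma eval_Proj_Suc: "eval (Proj i) xs v \<Longrightarrow> eval (Proj (Suc i)) (x # xs) v"
  by (erule eval.cases) (use eval_proj[of "Suc i" "x # xs"] in auto)

lemma node_clauses_pure:
  "c \<in> set (node_clauses nd) \<Longrightarrow> pure (fst c) \<and> pure (fst (snd c)) \<and> pure (snd (snd c))"
  by (cases nd rule: node_clauses.cases) (auto simp: tjudgement_def tcons_def)

section \<open>Soundness and completeness of the clauses\<close>

context pow_base
begin

lemma tmv_tcons [simp]: "tmv v (tcons s t) = cons (tmv v s) (tmv v t)"
  by (simp add: tcons_def cons_def pr_def)

lemma tmv_tjudgement [simp]: "tmv v (tjudgement nd s t) = judgement nd (tmv v s) (tmv v t)"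
  by (simp add: tjudgement_def judgement_def pr_def)

lemma node_clauses_vb:
  "c \<in> set (node_clauses nd) \<Longrightarrow> vb 4 (fst c) \<and> vb 4 (fst (snd c)) \<and> vb 4 (snd (snd c))"
  by (cases nd rule: node_clauses.cases) (auto simp: tjudgement_def tcons_def)

text \<open>Each clause mirrors a rule of \<open>eval\<close>. The hypotheses on the premises are
  conditional because a missing premise is 0, which is no judgement.\<close>

lemma node_clause_sound:
  assumes c: "(c0, c1, c2) \<in> set (node_clauses nd')"
    and c1: "\<And>nd l v. tmv z c1 = judgement nd l v \<Longrightarrow> sem nd l v"
    and c2: "\<And>nd l v. tmv z c2 = judgement nd l v \<Longrightarrow> sem nd l v"
    and c0: "tmv z c0 = judgement nd l v"
  shows "sem nd l v"
proof (cases nd' rule: node_clauses.cases)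
  case 1
  then show ?thesis using c c0 by (auto intro!: eval_zero)
next
  case 2
  then show ?thesis using c c0 by (auto simp: cons_eq_code intro!: eval_succ)
next
  case 3
  then show ?thesis using c c0 by (auto simp: cons_eq_code intro!: eval_Proj_0)
next
  case (4 i)
  then show ?thesis using c c0 c1[of "Ev (Proj i)" "z 1" "z 3"]
    by (auto simp: cons_eq_code intro!: eval_Proj_Suc)
next
  case (5 f gs)
  then have c012: "c0 = tjudgement (Ev (Comp f gs)) (Vr 1) (Vr 3)"
    "c1 = tjudgement (EvL gs) (Vr 1) (Vr 2)" "c2 = tjudgement (Ev f) (Vr 2) (Vr 3)"
    using c by auto
  have h: "sem (EvL gs) (z 1) (z 2)" "sem (Ev f) (z 2) (z 3)" using c1 c2 by (auto simp: c012)
  have nd: "nd = Ev (Comp f gs)" "l = z 1" "v = z 3" using c0 by (auto simp: c012)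
  have "eval (Comp f gs) xs v" if xs: "l = code xs" for xs
  proof -
    obtain ys where ys: "z 2 = code ys" "list_all2 (\<lambda>g y. eval g xs y) gs ys"
      using h(1) xs nd by auto
    then have "eval f ys v" using h(2) nd by simp
    with ys(2) show ?thesis by (rule eval_comp)
  qed
  then show ?thesis by (simp add: nd)
next
  case (6 f g)
  then consider "c0 = tjudgement (Ev (Prec f g)) (tcons (Cn 0) (Vr 1)) (Vr 3)"
      "c1 = tjudgement (Ev f) (Vr 1) (Vr 3)"
    | "c0 = tjudgement (Ev (Prec f g)) (tcons (Pl (Vr 0) (Cn 1)) (Vr 1)) (Vr 3)"
      "c1 = tjudgement (Ev (Prec f g)) (tcons (Vr 0) (Vr 1)) (Vr 2)"
      "c2 = tjudgement (Ev g) (tcons (Vr 0) (tcons (Vr 2) (Vr 1))) (Vr 3)"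
    using c by auto
  then show ?thesis
  proof cases
    case 1
    then have "sem (Ev f) (z 1) (z 3)" using c1 by auto
    then show ?thesis using c0 1 by (auto simp: cons_eq_code intro!: eval_prec0)
  next
    case 2
    have h: "sem (Ev (Prec f g)) (cons (z 0) (z 1)) (z 2)" "sem (Ev g) (cons (z 0) (cons (z 2) (z 1))) (z 3)"
      using c1 c2 2 by auto
    have nd: "nd = Ev (Prec f g)" "l = cons (Suc (z 0)) (z 1)" "v = z 3" using c0 by (auto simp: 2)
    have "eval (Prec f g) (Suc (z 0) # xs) v" if "z 1 = code xs" for xs
    proof (rule eval_precS)
      show "eval (Prec f g) (z 0 # xs) (z 2)" "eval g (z 0 # z 2 # xs) v"
        using h that nd by (auto simp: cons_eq_code)
    qed
    then show ?thesis by (auto simp: nd cons_eq_code)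
  qed
next
  case (7 f)
  then have c012: "c0 = tjudgement (Ev (Mini f)) (Vr 1) (Vr 0)"
    "c1 = tjudgement (Ev f) (tcons (Vr 0) (Vr 1)) (Cn 0)"
    "c2 = tjudgement (Below f) (tcons (Vr 0) (Vr 1)) (Cn 0)"
    using c by auto
  have h: "sem (Ev f) (cons (z 0) (z 1)) 0" "sem (Below f) (cons (z 0) (z 1)) 0"
    using c1 c2 by (auto simp: c012)
  have nd: "nd = Ev (Mini f)" "l = z 1" "v = z 0" using c0 by (auto simp: c012)
  have "eval (Mini f) xs v" if "l = code xs" for xs
  proof (rule eval_mini)
    show "eval f (v # xs) 0" "\<forall>m<v. \<exists>k. k \<noteq> 0 \<and> eval f (m # xs) k"
      using h that nd by (auto simp: cons_eq_code)
  qed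
  then show ?thesis by (simp add: nd)
next
  case 8
  then show ?thesis using c c0 by (auto intro!: exI[of _ "[]"])
next
  case (9 g gs)
  have c012: "c0 = tjudgement (EvL (g # gs)) (Vr 1) (tcons (Vr 0) (Vr 2))"
    "c1 = tjudgement (Ev g) (Vr 1) (Vr 0)" "c2 = tjudgement (EvL gs) (Vr 1) (Vr 2)"
    using c 9 by auto
  have h: "sem (Ev g) (z 1) (z 0)" "sem (EvL gs) (z 1) (z 2)" using c1 c2 by (auto simp: c012)
  have nd: "nd = EvL (g # gs)" "l = z 1" "v = cons (z 0) (z 2)" using c0 by (auto simp: c012)
  have "\<exists>ys. v = code ys \<and> list_all2 (\<lambda>g y. eval g xs y) (g # gs) ys" if xs: "l = code xs" for xs
  proof -
    obtain ys where "z 2 = code ys" "list_all2 (\<lambda>g y. eval g xs y) gs ys"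
      using h(2) xs nd by auto
    moreover have "eval g xs (z 0)" using h(1) xs nd by auto
    ultimately show ?thesis using nd by (intro exI[of _ "z 0 # ys"]) simp
  qed
  then show ?thesis by (simp add: nd)
next
  case (10 f)
  have "sem nd l v" if "c0 = tjudgement (Below f) (tcons (Cn 0) (Vr 1)) (Cn 0)"
    using that c0 by auto
  moreover have "sem nd l v" if "c0 = tjudgement (Below f) (tcons (Pl (Vr 0) (Cn 1)) (Vr 1)) (Cn 0)"
    "c1 = tjudgement (Below f) (tcons (Vr 0) (Vr 1)) (Cn 0)"
    "c2 = tjudgement (Ev f) (tcons (Vr 0) (Vr 1)) (Pl (Vr 2) (Cn 1))"
  proof -
    have h: "sem (Below f) (cons (z 0) (z 1)) 0" "sem (Ev f) (cons (z 0) (z 1)) (z 2 + 1)"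
      using c1 c2 that by auto
    have "\<exists>k. k \<noteq> 0 \<and> eval f (m # xs) k" if "z 1 = code xs" "m < Suc (z 0)" for m xs
    proof (cases "m = z 0")
      case True
      then show ?thesis using h(2) that by (intro exI[of _ "Suc (z 2)"]) auto
    next
      case False
      then show ?thesis using h(1) that by auto
    qed
    then show ?thesis using c0 that by auto
  qed
  ultimately show ?thesis using c 10 by auto
qed

lemma deriv_sound:
  assumes "deriv (clauses f) x" "x = judgement nd l v"
  shows "sem nd l v"
  using assms
proof (induction arbitrary: nd l v rule: deriv.induct)
  case (deriv_step c0 c1 c2 z)
  then obtain nd' where "(c0, c1, c2) \<in> set (node_clauses nd')" by (auto simp: clauses_def)
  then show ?case by (rule node_clause_sound) (use deriv_step in auto)
qed simp

text \<open>Lets the clause list stay fixed while the induction on \<open>eval\<close> descends to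
  subfunctions.\<close>

definition covers :: "(tm \<times> tm \<times> tm) list \<Rightarrow> node list \<Rightarrow> bool" where
  "covers C nds \<longleftrightarrow> (\<forall>nd \<in> set nds. set (node_clauses nd) \<subseteq> set C)"

lemma covers_simps [simp]:
  "covers C []" "covers C (nd # nds) \<longleftrightarrow> set (node_clauses nd) \<subseteq> set C \<and> covers C nds"
  "covers C (nds @ nds') \<longleftrightarrow> covers C nds \<and> covers C nds'"
  by (auto simp: covers_def)

text \<open>\<open>z\<close> instantiates the clause variables in the order fixed by \<open>node_clauses\<close>.\<close>
lemma deriv_clause:
  assumes "(c0, c1, c2) \<in> set C" "z = (\<lambda>i. [x, l, y, v] ! i)"
    "deriv C (tmv z c1)" "deriv C (tmv z c2)" "tmv z c0 = n"
  shows "deriv C n"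
  using deriv_step[OF assms(1), of z] assms by simp

lemma deriv_Proj:
  "\<lbrakk>i < length xs; \<forall>j\<le>i. set (node_clauses (Ev (Proj j))) \<subseteq> set C\<rbrakk>
    \<Longrightarrow> deriv C (judgement (Ev (Proj i)) (code xs) (xs ! i))"
proof (induction i arbitrary: xs)
  case 0
  then obtain x xs' where xs: "xs = x # xs'" by (cases xs) auto
  show ?case
    by (rule deriv_clause[of _ _ _ C _ x "code xs'" 0 0, OF _ refl])
      (use 0 in \<open>auto simp: xs deriv_0\<close>)
next
  case (Suc i)
  then obtain x xs' where xs: "xs = x # xs'" by (cases xs) auto
  have IH: "deriv C (judgement (Ev (Proj i)) (code xs') (xs' ! i))"
    using Suc by (simp add: xs)
  have cl: "set (node_clauses (Ev (Proj (Suc i)))) \<subseteq> set C" using Suc.prems by blast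
  show ?case
    by (rule deriv_clause[of "tjudgement (Ev (Proj (Suc i))) (tcons (Vr 0) (Vr 1)) (Vr 3)" _ _ C _ x "code xs'" 0 "xs' ! i", OF _ refl])
      (use IH cl in \<open>auto simp: xs deriv_0\<close>)
qed

lemma deriv_EvL:
  assumes "list_all2 (\<lambda>g y. deriv C (judgement (Ev g) l y)) gs ys" "covers C (map EvL (tails gs))"
  shows "deriv C (judgement (EvL gs) l (code ys))"
  using assms
proof (induction rule: list_all2_induct)
  case Nil
  show ?case
    by (rule deriv_clause[of "tjudgement (EvL []) (Vr 1) (Cn 0)" "Cn 0" "Cn 0" C _ 0 l 0 0, OF _ refl])
      (use Nil in \<open>auto simp: deriv_0\<close>)
next
  case (Cons g gs y ys)
  have IH: "deriv C (judgement (EvL gs) l (code ys))" using Cons by simp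
  show ?case
    by (rule deriv_clause[of "tjudgement (EvL (g # gs)) (Vr 1) (tcons (Vr 0) (Vr 2))"
          "tjudgement (Ev g) (Vr 1) (Vr 0)" "tjudgement (EvL gs) (Vr 1) (Vr 2)" C _ y l "code ys" 0, OF _ refl])
      (use Cons IH in auto)
qed

lemma deriv_complete:
  "eval f xs v \<Longrightarrow> covers C (nodes f) \<Longrightarrow> deriv C (judgement (Ev f) (code xs) v)"
proof (induction rule: eval.induct)
  case (eval_zero xs)
  show ?case
    by (rule deriv_clause[of "tjudgement (Ev Zero) (Vr 1) (Cn 0)" "Cn 0" "Cn 0" C _ 0 "code xs" 0 0, OF _ refl])
      (use eval_zero in \<open>auto simp: deriv_0\<close>)
next
  case (eval_succ x xs)
  show ?case
    by (rule deriv_clause[of "tjudgement (Ev Succ) (tcons (Vr 0) (Vr 1)) (Pl (Vr 0) (Cn 1))"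
          "Cn 0" "Cn 0" C _ x "code xs" 0 0, OF _ refl])
      (use eval_succ in \<open>auto simp: deriv_0\<close>)
next
  case (eval_proj i xs)
  have "Ev (Proj j) \<in> set (nodes (Proj i))" if "j \<le> i" for j
    using that by (auto simp: less_Suc_eq_le simp del: upt_Suc)
  then have "\<forall>j\<le>i. set (node_clauses (Ev (Proj j))) \<subseteq> set C"
    using eval_proj.prems unfolding covers_def by blast
  with eval_proj.hyps show ?case by (rule deriv_Proj)
next
  case (eval_comp xs gs ys f z)
  have "covers C (nodes g)" if "g \<in> set gs" for g
    using eval_comp.prems that by (auto simp: covers_def)
  then have "list_all2 (\<lambda>g y. deriv C (judgement (Ev g) (code xs) y)) gs ys"
    using eval_comp.IH(1) by (auto simp: list_all2_conv_all_nth)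
  then have L: "deriv C (judgement (EvL gs) (code xs) (code ys))"
    using eval_comp.prems by (intro deriv_EvL) auto
  show ?case
    by (rule deriv_clause[of "tjudgement (Ev (Comp f gs)) (Vr 1) (Vr 3)"
          "tjudgement (EvL gs) (Vr 1) (Vr 2)" "tjudgement (Ev f) (Vr 2) (Vr 3)" C _ 0 "code xs" "code ys" z, OF _ refl])
      (use eval_comp L in auto)
next
  case (eval_prec0 f xs z g)
  show ?case
    by (rule deriv_clause[of "tjudgement (Ev (Prec f g)) (tcons (Cn 0) (Vr 1)) (Vr 3)"
          "tjudgement (Ev f) (Vr 1) (Vr 3)" "Cn 0" C _ 0 "code xs" 0 z, OF _ refl])
      (use eval_prec0 in \<open>auto simp: deriv_0\<close>)
next
  case (eval_precS f g n xs y z)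
  show ?case
    by (rule deriv_clause[of "tjudgement (Ev (Prec f g)) (tcons (Pl (Vr 0) (Cn 1)) (Vr 1)) (Vr 3)"
          "tjudgement (Ev (Prec f g)) (tcons (Vr 0) (Vr 1)) (Vr 2)"
          "tjudgement (Ev g) (tcons (Vr 0) (tcons (Vr 2) (Vr 1))) (Vr 3)" C _ n "code xs" y z, OF _ refl])
      (use eval_precS in auto)
next
  case (eval_mini f n xs)
  have cov: "covers C (nodes f)" using eval_mini.prems by simp
  \<comment> \<open>The judgement for \<open>n\<close> is built up one argument at a time.\<close>
  have "deriv C (judgement (Below f) (cons m (code xs)) 0)" if "m \<le> n" for m
    using that
  proof (induction m)
    case 0
    show ?case
      by (rule deriv_clause[of "tjudgement (Below f) (tcons (Cn 0) (Vr 1)) (Cn 0)" "Cn 0" "Cn 0"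
            C _ 0 "code xs" 0 0, OF _ refl])
        (use eval_mini.prems in \<open>auto simp: deriv_0\<close>)
  next
    case (Suc m)
    then have "m < n" by simp
    then obtain k where "k \<noteq> 0" "deriv C (judgement (Ev f) (code (m # xs)) k)"
      using eval_mini.IH(2) cov by blast
    \<comment> \<open>The clause writes a nonzero value as a successor.\<close>
    then obtain k' where k': "deriv C (judgement (Ev f) (code (m # xs)) (Suc k'))"
      by (cases k) auto
    show ?case
      by (rule deriv_clause[of "tjudgement (Below f) (tcons (Pl (Vr 0) (Cn 1)) (Vr 1)) (Cn 0)"
            "tjudgement (Below f) (tcons (Vr 0) (Vr 1)) (Cn 0)"
            "tjudgement (Ev f) (tcons (Vr 0) (Vr 1)) (Pl (Vr 2) (Cn 1))" C _ m "code xs" k' 0, OF _ refl])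
        (use eval_mini.prems k' Suc in auto)
  qed
  then have B: "deriv C (judgement (Below f) (cons n (code xs)) 0)" by simp
  show ?case
    by (rule deriv_clause[of "tjudgement (Ev (Mini f)) (Vr 1) (Vr 0)"
          "tjudgement (Ev f) (tcons (Vr 0) (Vr 1)) (Cn 0)" "tjudgement (Below f) (tcons (Vr 0) (Vr 1)) (Cn 0)"
          C _ n "code xs" 0 0, OF _ refl])
      (use eval_mini.prems eval_mini.IH(1)[OF cov] B in auto)
qed

lemma dio_eval: "dio (\<lambda>v. eval f [v 0] x)"
proof -
  have "eval f [n] x \<longleftrightarrow> deriv (clauses f) (judgement (Ev f) (cons n 0) x)" for n
  proof
    assume "eval f [n] x"
    then have "deriv (clauses f) (judgement (Ev f) (code [n]) x)"
      by (rule deriv_complete) (auto simp: covers_def clauses_def)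
    then show "deriv (clauses f) (judgement (Ev f) (cons n 0) x)" by simp
  next
    assume "deriv (clauses f) (judgement (Ev f) (cons n 0) x)"
    from deriv_sound[OF this refl] show "eval f [n] x" by (auto simp: cons_eq_code)
  qed
  moreover have "dio (\<lambda>v. deriv (clauses f) (judgement (Ev f) (cons (v 0) 0) x))"
  proof (rule dio_deriv)
    show "tmf (\<lambda>v. judgement (Ev f) (cons (v 0) 0) x)"
      unfolding tmf_def
      by (rule exI[of _ "tjudgement (Ev f) (tcons (Vr 0) (Cn 0)) (Cn x)"]) simp
  qed (use node_clauses_pure node_clauses_vb in \<open>auto simp: clauses_def\<close>)
  ultimately show ?thesis by simp
qed

end

section \<open>Diagonalisation\<close>

text \<open>\<open>0 + 0 = 0\<close> pins down zero, and larger constants are reached by adding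
  one.\<close>

fun const_atoms :: "nat \<Rightarrow> tm atom list" where
  "const_atoms 0 = [IsSum (Cn 0) (Cn 0) (Cn 0)]"
| "const_atoms (Suc c) = [IsOne (Cn 1), IsSum (Cn c) (Cn 1) (Cn (Suc c))] @ const_atoms c"

text \<open>The other atoms compute \<open>k\<close> and \<open>m\<close> and thereby discharge the
  premises of \<open>zsat\<close> for \<open>IsExp\<close>.\<close>

definition exp_atoms :: "tm \<Rightarrow> tm atom list" where
  "exp_atoms s = (let y = Pw s; k = Pl (Pl (Tm y y) (Tm s s)) (Cn 1) in
     [IsProd y y (Tm y y), IsProd s s (Tm s s), IsSum (Tm y y) (Tm s s) (Pl (Tm y y) (Tm s s)),
      IsOne (Cn 1), IsSum (Pl (Tm y y) (Tm s s)) (Cn 1) k, IsProd k y (Tm k y), IsExp s y k (Tm k y)])"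

text \<open>The unknowns are named by terms. Each variable is exponentiated, because this is what forces
  its value to be nonnegative.\<close>
fun tm_atoms :: "tm \<Rightarrow> tm atom list" where
  "tm_atoms (Vr i) = exp_atoms (Vr i)"
| "tm_atoms (Cn c) = const_atoms c"
| "tm_atoms (Pl s t) = IsSum s t (Pl s t) # tm_atoms s @ tm_atoms t"
| "tm_atoms (Tm s t) = IsProd s t (Tm s t) # tm_atoms s @ tm_atoms t"
| "tm_atoms (Pw s) = exp_atoms s @ tm_atoms s"

definition eqs_atoms :: "(tm \<times> tm) list \<Rightarrow> tm atom list" where
  "eqs_atoms eqs = concat (map (\<lambda>(l, r). IsSum l (Cn 0) r # const_atoms 0 @ tm_atoms l @ tm_atoms r) eqs)"

section \<open>From Diophantine relations to systems over the group\<close>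

context gbs
begin

sublocale pow_base P
  using p_ge by unfold_locales simp

lemma nsat_tm_atoms: "list_all (nsat (tmv w)) (tm_atoms t)"
proof (induction t)
  case (Cn c)
  show ?case by (induction c) auto
qed (auto simp: exp_atoms_def Let_def)

lemma zsat_exp_atoms:
  assumes "list_all (zsat z) (exp_atoms s)"
  shows "0 \<le> z s \<and> z (Pw s) = p ^ nat (z s)"
  using assms by (auto simp: exp_atoms_def Let_def)

lemma zsat_const_atoms: "list_all (zsat z) (const_atoms c) \<Longrightarrow> z (Cn c) = int c"
  by (induction c) auto

text \<open>Exponentiation makes the variables nonnegative, so \<open>nat\<close> loses nothing;
  every other term is determined by its subterms.\<close>

lemma zsat_tm_atoms:
  "list_all (zsat z) (tm_atoms t) \<Longrightarrow> z t = int (tmv (\<lambda>i. nat (z (Vr i))) t)"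
proof (induction t)
  case (Vr i)
  then show ?case using zsat_exp_atoms by simp
next
  case (Cn c)
  then show ?case using zsat_const_atoms by simp
next
  case (Pw s)
  then have "z s = int (tmv (\<lambda>i. nat (z (Vr i))) s)" by simp
  then show ?case using Pw.prems zsat_exp_atoms[of z s] p_ge by simp
qed auto

abbreviation param_var :: nat where
  "param_var \<equiv> to_nat (Num (Vr 0) :: tm gvar)"

lemma dio_imp_system:
  assumes "dio (\<lambda>v. R (v 0))"
  shows "\<exists>sys. \<forall>n. solvable p q (param_word param_var n # sys) \<longleftrightarrow> R n"
proof -
  obtain eqs k where R: "\<And>v. R (v 0) \<longleftrightarrow> (\<exists>w. esat (app k w v) eqs)"
    using assms unfolding dio_def by blast
  \<comment> \<open>The unknowns become variables 1 to \<open>k\<close>. All arguments are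
    identified with variable 0, which is legitimate because \<open>R\<close> depends on
    \<open>v 0\<close> only.\<close>
  define \<theta> where "\<theta> i = (if i < k then Vr (Suc i) else Vr 0)" for i
  define eqs' where "eqs' = map (\<lambda>(l, r). (tsub \<theta> l, tsub \<theta> r)) eqs"
  have "(\<lambda>i. tmv w (\<theta> i)) = app k (\<lambda>i. w (Suc i)) (\<lambda>_. w 0)" for w
    by (auto simp: \<theta>_def app_def)
  then have eqs': "esat w eqs' \<longleftrightarrow> esat (app k (\<lambda>i. w (Suc i)) (\<lambda>_. w 0)) eqs" for w
    unfolding eqs'_def esat_tsub by simp
  have "solvable p q (param_word param_var n # atoms_system (eqs_atoms eqs')) \<longleftrightarrow> R n" for n
  proof
    assume "R n"
    then obtain w where "esat (app k w (\<lambda>_. n)) eqs" using R[of "\<lambda>_. n"] by blast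
    then have "esat (case_nat n w) eqs'" unfolding eqs' by simp
    then have "\<forall>a \<in> set (eqs_atoms eqs'). nsat (tmv (case_nat n w)) a"
      using nsat_tm_atoms[unfolded list_all_iff]
      by (fastforce simp: eqs_atoms_def esat_def)
    from atoms_system_complete[OF this, of "Vr 0"]
    show "solvable p q (param_word param_var n # atoms_system (eqs_atoms eqs'))" by simp
  next
    assume "solvable p q (param_word param_var n # atoms_system (eqs_atoms eqs'))"
    from atoms_system_sound[OF this] obtain z where z: "z (Vr 0) = int n"
      "\<And>a. a \<in> set (eqs_atoms eqs') \<Longrightarrow> zsat z a" by blast
    define w where "w i = nat (z (Vr i))" for i
    have "tmv w l = tmv w r" if lr: "(l, r) \<in> set eqs'" for l r
    proof -
      have sub: "set (IsSum l (Cn 0) r # const_atoms 0 @ tm_atoms l @ tm_atoms r) \<subseteq> set (eqs_atoms eqs')"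
        unfolding eqs_atoms_def using lr by fastforce
      have "list_all (zsat z) (tm_atoms l)" "list_all (zsat z) (tm_atoms r)"
        using sub z(2) by (auto simp: list_all_iff)
      then have "z l = int (tmv w l)" "z r = int (tmv w r)"
        using zsat_tm_atoms unfolding w_def by blast+
      moreover have "zsat z (IsSum l (Cn 0) r)" "zsat z (IsSum (Cn 0) (Cn 0) (Cn 0))"
        using sub by (intro z(2); auto)+
      ultimately show ?thesis by simp
    qed
    then have "esat w eqs'" by (auto simp: esat_def)
    then show "R n" using eqs'[of w] R[of "\<lambda>_. w 0"] z(1) by (auto simp: w_def)
  qed
  then show ?thesis by blast
qed

end

text \<open>For \<open>Mini\<close>, the smaller of two results would be an argument at which
  \<open>f\<close> is both zero and nonzero.\<close>

lemma eval_deterministic: "eval f xs v \<Longrightarrow> eval f xs w \<Longrightarrow> w = v"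
proof (induction arbitrary: w rule: eval.induct)
  case (eval_comp xs gs ys f z)
  from eval_comp.prems obtain ys' where ys': "list_all2 (\<lambda>g y. eval g xs y) gs ys'" "eval f ys' w"
    by (cases rule: eval.cases) auto
  have "ys' = ys"
    using eval_comp.IH(1) ys'(1) by (auto simp: list_all2_conv_all_nth intro!: nth_equalityI)
  then show ?case using eval_comp.IH(2) ys'(2) by blast
next
  case (eval_precS f g n xs y z)
  from eval_precS.prems obtain y' where "eval (Prec f g) (n # xs) y'" "eval g (n # y' # xs) w"
    by (cases rule: eval.cases) auto
  then show ?case using eval_precS.IH by blast
next
  case (eval_mini f n xs)
  from eval_mini.prems have w: "eval f (w # xs) 0" "\<forall>m<w. \<exists>k. k \<noteq> 0 \<and> eval f (m # xs) k"
    by (cases rule: eval.cases; auto)+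
  have "\<not> w < n" using eval_mini.IH(2) w(1) by blast
  moreover have "\<not> n < w" using eval_mini.IH(1) w(2) by blast
  ultimately show ?case by simp
qed (erule eval.cases; auto)+

lemma eval_Comp1: "eval g xs y \<Longrightarrow> eval f [y] z \<Longrightarrow> eval (Comp f [g]) xs z"
  by (rule eval_comp[of _ _ "[y]"]) auto

lemma eval_Comp2: "eval g xs y \<Longrightarrow> eval h xs y' \<Longrightarrow> eval f [y, y'] z \<Longrightarrow> eval (Comp f [g, h]) xs z"
  by (rule eval_comp[of _ _ "[y, y']"]) auto

lemma eval_Proj_nth: "i < length xs \<Longrightarrow> x = xs ! i \<Longrightarrow> eval (Proj i) xs x"
  by (simp add: eval_proj)

section \<open>Recursive functions on codes of systems\<close>

definition add_recf :: recf where
  "add_recf = Prec (Proj 0) (Comp Succ [Proj 1])"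

definition triangle_recf :: recf where
  "triangle_recf = Prec Zero (Comp Succ [Comp add_recf [Proj 0, Proj 1]])"

definition pair_recf :: recf where
  "pair_recf = Comp add_recf [Comp triangle_recf [add_recf], Proj 0]"

fun const_recf :: "nat \<Rightarrow> recf" where
  "const_recf 0 = Zero"
| "const_recf (Suc c) = Comp Succ [const_recf c]"

text \<open>The letter \<open>s\<close> has code 2; prepending a letter to an encoded list is the
  successor of a pair.\<close>

definition spow_recf :: recf where
  "spow_recf = Prec Zero (Comp Succ [Comp pair_recf [const_recf 2, Proj 1]])"

text \<open>Maps the code \<open>n\<close> of a system to the code of that system with
  \<open>x = s^n\<close> in front; \<open>2 * (r + 3) + 1\<close> is the code of the inverse of
  variable \<open>r\<close>.\<close>

definition diagonal_recf :: "nat \<Rightarrow> recf" where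
  "diagonal_recf r = Comp Succ [Comp pair_recf
     [Comp Succ [Comp pair_recf [const_recf (2 * (r + 3) + 1), spow_recf]], Proj 0]]"

lemma eval_add: "eval add_recf [m, n] (m + n)"
  unfolding add_recf_def
proof (induction m)
  case 0
  show ?case by (intro eval_prec0 eval_Proj_nth) auto
next
  case (Suc m)
  show ?case by (rule eval_precS[OF Suc]) (auto intro!: eval_Comp1 eval_succ eval_Proj_nth)
qed

lemma eval_triangle: "eval triangle_recf [n] (triangle n)"
  unfolding triangle_recf_def
proof (induction n)
  case 0
  show ?case by (intro eval_prec0) (simp add: eval_zero)
next
  case (Suc n)
  have "eval (Comp add_recf [Proj 0, Proj 1]) [n, triangle n] (n + triangle n)"
    by (rule eval_Comp2[OF _ _ eval_add]) (auto intro: eval_Proj_nth)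
  then have "eval (Comp Succ [Comp add_recf [Proj 0, Proj 1]]) [n, triangle n] (Suc (n + triangle n))"
    by (rule eval_Comp1[OF _ eval_succ])
  then show ?case by (intro eval_precS[OF Suc]) (simp add: add.commute)
qed

lemma eval_pair: "eval pair_recf [m, n] (prod_encode (m, n))"
  unfolding pair_recf_def prod_encode_def prod.case
  by (rule eval_Comp2[OF eval_Comp1[OF eval_add eval_triangle] _ eval_add]) (auto intro: eval_Proj_nth)

lemma eval_const: "eval (const_recf c) xs c"
  by (induction c) (auto intro: eval_zero eval_Comp1 eval_succ)

lemma eval_spow: "eval spow_recf [n] (list_encode (replicate n 2))"
  unfolding spow_recf_def
proof (induction n)
  case 0
  show ?case by (intro eval_prec0) (simp add: eval_zero)
next
  case (Suc n)
  let ?y = "list_encode (replicate n 2)"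
  have "eval (Comp pair_recf [const_recf 2, Proj 1]) [n, ?y] (prod_encode (2, ?y))"
    by (rule eval_Comp2[OF eval_const _ eval_pair]) (auto intro: eval_Proj_nth)
  then have "eval (Comp Succ [Comp pair_recf [const_recf 2, Proj 1]]) [n, ?y] (Suc (prod_encode (2, ?y)))"
    by (rule eval_Comp1[OF _ eval_succ])
  then show ?case by (intro eval_precS[OF Suc]) simp
qed

lemma eval_diagonal:
  assumes "n = encode_system sys"
  shows "eval (diagonal_recf r) [n] (encode_system (param_word r n # sys))"
proof -
  have "encode_system (param_word r n # sys) =
     Suc (prod_encode (Suc (prod_encode (2 * (r + 3) + 1, list_encode (replicate n 2))), n))"
    by (simp add: encode_system_def param_word_def letter_code_def sym_code_def assms)
  moreover have "eval (Comp Succ [Comp pair_recf [const_recf (2 * (r + 3) + 1), spow_recf]]) [n]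
     (Suc (prod_encode (2 * (r + 3) + 1, list_encode (replicate n 2))))"
    by (rule eval_Comp1[OF eval_Comp2[OF eval_const eval_spow eval_pair] eval_succ])
  ultimately show ?thesis unfolding diagonal_recf_def
    by (auto intro!: eval_Comp1[OF eval_Comp2[OF _ _ eval_pair] eval_succ] eval_Proj_nth)
qed

theorem theorem3p4:
  fixes p q :: int
  assumes "prime p" and "prime q" and "p \<noteq> q"
  shows "\<not> (\<exists>f. \<forall>sys. eval f [encode_system sys] (if solvable p q sys then 1 else 0))"
proof
  assume "\<exists>f. \<forall>sys. eval f [encode_system sys] (if solvable p q sys then 1 else 0)"
  then obtain f where f: "\<And>sys. eval f [encode_system sys] (if solvable p q sys then 1 else 0)" by blast
  interpret gbs p q by unfold_locales (fact assms)+
  define h where "h = Comp f [diagonal_recf param_var]"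
  obtain sys where sys: "\<And>n. solvable p q (param_word param_var n # sys) \<longleftrightarrow> eval h [n] 0"
    using dio_imp_system[OF dio_eval] by blast
  \<comment> \<open>With this \<open>n\<close>, the value of \<open>h\<close> at \<open>n\<close> is
    the verdict of \<open>f\<close> on the very system that is solvable iff this verdict is
    0.\<close>
  define n where "n = encode_system sys"
  have "eval h [n] (if solvable p q (param_word param_var n # sys) then 1 else 0)"
    unfolding h_def by (rule eval_Comp1[OF eval_diagonal[OF n_def] f])
  then show False using sys[of n] eval_deterministic by fastforce
qed

end
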